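(* Let $\Sigma$ be a closed Riemann surface of genus $g\ge2$, $n\ge2$, $0\not\equiv q_n\in H^0(\Sigma,K^n)$, and let $h_t=h_1(t)\oplus\cdots\oplus h_n(t)$ be the harmonic metric of the Higgs bundle $(E,\tilde e_1+tq_ne_{n-1})$, $t>0$. Away from the zeros of $q_n$ define the error functions $\tilde u^j$ ($1\le j\le n$, depending on $t$) by $$h_j(t)=(t|q_n|)^{-\frac{n+1-2j}n}e^{-\tilde u^j},$$ put $d^j=\tilde u^j$ with indices in $\mathbb Z_n$, and set $w_k=\frac1{\sqrt n}\sum_{i\in\mathbb Z_n}\zeta_n^{ik}(d^i-d^{i+1})$, $\zeta_n=e^{2\pi i/n}$. Let $P$ be a point away from the zeros of $q_n$, $z$ a local coordinate centered at $P$ with $q_n=dz^n$, and $D=\{|z|<R\}$ a disk of radius $R$ in this coordinate chart. Then for every $k$, as $t\to\infty$, on $D$ $$w_k(z)=O\left(t^{-\frac3{2n}}e^{-2|1-\zeta_n^k|t^{\frac1n}(R-|z|)}\right).$$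
   Context: $K$ is the canonical bundle of $\Sigma$, $K^{1/2}$ a fixed square root, and $E=\bigoplus_{j=1}^nK^{\frac{n+1-2j}2}$. The Higgs field $\phi_t=\tilde e_1+tq_ne_{n-1}:E\to E\otimes K$ is the matrix with $(i+1,i)$ entries $1$ ($1\le i\le n-1$), $(1,n)$ entry $tq_n$, zeros elsewhere. $(E,\phi_t)$ is stable and its harmonic metric $h_t$ is the unique Hermitian metric on $E$ (inducing the trivial metric on $\det E=\mathcal O$) with $F_{A_{h_t}}+[\phi_t,\phi_t^{*_{h_t}}]=0$; it is diagonal with $h_j(t)$ a metric on $K^{(n+1-2j)/2}$ and $h_{n+1-j}=h_j^{-1}$. In a coordinate with $q_n=dz^n$ one has $|q_n|=1$ and $h_j(t)$ is identified with $h_j(t)(dz^{(n+1-2j)/2},dz^{(n+1-2j)/2})$. The closed disk $\overline D$ is contained in the coordinate chart (hence avoids the zeros of $q_n$), and the $O$ is uniform in $z\in D$. *)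

theory Defs
  imports
    "HOL-Analysis.Analysis"
    "HOL-Homology.Homology"
    "HOL-Algebra.Free_Abelian_Groups"
    "Jordan_Normal_Form.Determinant"
    "Jordan_Normal_Form.Schur_Decomposition"
begin

section \<open>Riemann surfaces\<close>

text \<open>A chart is a pair of its domain and its coordinate function; the values of the coordinate
  function outside the domain are irrelevant.\<close>

type_synonym 'a chart = "'a set \<times> ('a \<Rightarrow> complex)"

abbreviation cdom :: "'a chart \<Rightarrow> 'a set" where "cdom c \<equiv> fst c"
abbreviation coord :: "'a chart \<Rightarrow> 'a \<Rightarrow> complex" where "coord c \<equiv> snd c"

definition chart_inv :: "'a chart \<Rightarrow> complex \<Rightarrow> 'a" where
  "chart_inv c = inv_into (cdom c) (coord c)"

definition complex_chart :: "'a topology \<Rightarrow> 'a chart \<Rightarrow> bool" where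
  "complex_chart X c \<longleftrightarrow>
     openin X (cdom c) \<and> open (coord c ` cdom c) \<and>
     homeomorphic_map (subtopology X (cdom c)) (top_of_set (coord c ` cdom c)) (coord c)"

definition transition :: "'a chart \<Rightarrow> 'a chart \<Rightarrow> complex \<Rightarrow> complex" where
  "transition c d = coord d \<circ> chart_inv c"

definition compatible :: "'a chart \<Rightarrow> 'a chart \<Rightarrow> bool" where
  "compatible c d \<longleftrightarrow>
     transition c d holomorphic_on coord c ` (cdom c \<inter> cdom d) \<and>
     transition d c holomorphic_on coord d ` (cdom c \<inter> cdom d)"

text \<open>\<open>dcoord c d p\<close> is the function $dz_d/dz_c$ at the point \<open>p\<close> of the overlap.\<close>

definition dcoord :: "'a chart \<Rightarrow> 'a chart \<Rightarrow> 'a \<Rightarrow> complex" where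
  "dcoord c d p = deriv (transition c d) (coord c p)"

text \<open>The atlas is not required to be maximal.\<close>

definition closed_riemann_surface :: "'a topology \<Rightarrow> 'a chart set \<Rightarrow> bool" where
  "closed_riemann_surface X A \<longleftrightarrow>
     Hausdorff_space X \<and> compact_space X \<and> connected_space X \<and> topspace X \<noteq> {} \<and>
     (\<forall>c\<in>A. complex_chart X c) \<and> (\<Union>c\<in>A. cdom c) = topspace X \<and>
     (\<forall>c\<in>A. \<forall>d\<in>A. compatible c d)"

definition local_coordinate :: "'a topology \<Rightarrow> 'a chart set \<Rightarrow> 'a chart \<Rightarrow> bool" where
  "local_coordinate X A z \<longleftrightarrow> complex_chart X z \<and> (\<forall>c\<in>A. compatible c z)"

definition has_genus :: "'a topology \<Rightarrow> nat \<Rightarrow> bool" where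
  "has_genus X g \<longleftrightarrow> homology_group 1 X \<cong> free_Abelian_group {..<2 * g}"

section \<open>Holomorphic differentials and square roots of the canonical bundle\<close>

text \<open>A section of $K^m$ is given by its coefficients \<open>q c\<close> with respect to $dz_c^m$.\<close>

definition holomorphic_differential :: "'a chart set \<Rightarrow> nat \<Rightarrow> ('a chart \<Rightarrow> 'a \<Rightarrow> complex) \<Rightarrow> bool" where
  "holomorphic_differential A m q \<longleftrightarrow>
     (\<forall>c\<in>A. (q c \<circ> chart_inv c) holomorphic_on coord c ` cdom c) \<and>
     (\<forall>c\<in>A. \<forall>d\<in>A. \<forall>p \<in> cdom c \<inter> cdom d. q c p = q d p * dcoord c d p ^ m)"

text \<open>A square root $K^{1/2}$ is given by the transition functions
  $dz_d^{1/2} = s_{cd}\, dz_c^{1/2}$ between local frames whose squares are the $dz_c$.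
  Every square root of $K$ is of this form for an atlas consisting of simply connected charts.
  (For a maximal atlas such frames need not exist: on an annular chart the restriction of
  $K^{1/2}$ may have no global section squaring to $dz_c$.)\<close>

definition canonical_sqrt :: "'a chart set \<Rightarrow> ('a chart \<Rightarrow> 'a chart \<Rightarrow> 'a \<Rightarrow> complex) \<Rightarrow> bool" where
  "canonical_sqrt A s \<longleftrightarrow>
     (\<forall>c\<in>A. \<forall>d\<in>A. (s c d \<circ> chart_inv c) holomorphic_on coord c ` (cdom c \<inter> cdom d)) \<and>
     (\<forall>c\<in>A. \<forall>d\<in>A. \<forall>p \<in> cdom c \<inter> cdom d. (s c d p)\<^sup>2 = dcoord c d p) \<and>
     (\<forall>c\<in>A. \<forall>d\<in>A. \<forall>e\<in>A. \<forall>p \<in> cdom c \<inter> cdom d \<inter> cdom e. s c e p = s c d p * s d e p)"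

section \<open>Smooth functions and Wirtinger derivatives\<close>

text \<open>The sets \<open>S\<close> below are open; smoothness is meant in the real sense.\<close>

primrec Ck_on :: "nat \<Rightarrow> complex set \<Rightarrow> (complex \<Rightarrow> complex) \<Rightarrow> bool" where
  "Ck_on 0 S f \<longleftrightarrow> continuous_on S f"
| "Ck_on (Suc k) S f \<longleftrightarrow> f differentiable_on S \<and>
     Ck_on k S (\<lambda>z. frechet_derivative f (at z) 1) \<and>
     Ck_on k S (\<lambda>z. frechet_derivative f (at z) \<i>)"

definition smooth_on :: "complex set \<Rightarrow> (complex \<Rightarrow> complex) \<Rightarrow> bool" where
  "smooth_on S f \<longleftrightarrow> (\<forall>k. Ck_on k S f)"

definition ddz :: "(complex \<Rightarrow> complex) \<Rightarrow> complex \<Rightarrow> complex" where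
  "ddz f z = (frechet_derivative f (at z) 1 - \<i> * frechet_derivative f (at z) \<i>) / 2"

definition ddzbar :: "(complex \<Rightarrow> complex) \<Rightarrow> complex \<Rightarrow> complex" where
  "ddzbar f z = (frechet_derivative f (at z) 1 + \<i> * frechet_derivative f (at z) \<i>) / 2"

definition mat_ddz :: "nat \<Rightarrow> (complex \<Rightarrow> complex mat) \<Rightarrow> complex \<Rightarrow> complex mat" where
  "mat_ddz n M z = Matrix.mat n n (\<lambda>(i, j). ddz (\<lambda>w. M w $$ (i, j)) z)"

definition mat_ddzbar :: "nat \<Rightarrow> (complex \<Rightarrow> complex mat) \<Rightarrow> complex \<Rightarrow> complex mat" where
  "mat_ddzbar n M z = Matrix.mat n n (\<lambda>(i, j). ddzbar (\<lambda>w. M w $$ (i, j)) z)"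

definition inverse_mat :: "complex mat \<Rightarrow> complex mat" where
  "inverse_mat M = (1 / Determinant.det M) \<cdot>\<^sub>m adj_mat M"

section \<open>The Higgs bundle and its harmonic metric\<close>

text \<open>On a chart \<open>c\<close>, $E = \bigoplus_{j=1}^n K^{(n+1-2j)/2}$ has the frame
  $e^c_j = (dz_c^{1/2})^{n+1-2j}$. Matrix indices start at 0, so position \<open>i\<close> is $j = i + 1$.
  Frames are related by $e^d = e^c g_{cd}$.\<close>

definition E_transition ::
  "nat \<Rightarrow> ('a chart \<Rightarrow> 'a chart \<Rightarrow> 'a \<Rightarrow> complex) \<Rightarrow> 'a chart \<Rightarrow> 'a chart \<Rightarrow> 'a \<Rightarrow> complex mat" where
  "E_transition n s c d p = mat_diag n (\<lambda>i. s c d p powi (int n - 1 - 2 * int i))"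

text \<open>The endomorphism-valued form $\tilde e_1 + t q e_{n-1}$ in the chart \<open>c\<close> is
  \<open>higgs_field n t q c\<close> times $dz_c$.\<close>

definition higgs_field ::
  "nat \<Rightarrow> real \<Rightarrow> ('a chart \<Rightarrow> 'a \<Rightarrow> complex) \<Rightarrow> 'a chart \<Rightarrow> 'a \<Rightarrow> complex mat" where
  "higgs_field n t q c p = Matrix.mat n n (\<lambda>(i, j).
     if i = j + 1 then 1 else if i = 0 \<and> j = n - 1 then of_real t * q c p else 0)"

text \<open>A Hermitian metric on $E$ is given by its Gram matrices, with the convention
  $h(v, w) = w^\dagger H_c v$ for coordinate vectors with respect to $e^c$.\<close>

definition hermitian_metric ::
  "'a chart set \<Rightarrow> nat \<Rightarrow> ('a chart \<Rightarrow> 'a chart \<Rightarrow> 'a \<Rightarrow> complex) \<Rightarrow> ('a chart \<Rightarrow> 'a \<Rightarrow> complex mat) \<Rightarrow> bool" where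
  "hermitian_metric A n s H \<longleftrightarrow>
     (\<forall>c\<in>A. \<forall>p \<in> cdom c. H c p \<in> carrier_mat n n \<and> mat_adjoint (H c p) = H c p \<and>
        (\<forall>v \<in> carrier_vec n. v \<noteq> 0\<^sub>v n \<longrightarrow> 0 < Re ((H c p *\<^sub>v v) \<bullet>c v))) \<and>
     (\<forall>c\<in>A. \<forall>i<n. \<forall>j<n. smooth_on (coord c ` cdom c) (\<lambda>z. H c (chart_inv c z) $$ (i, j))) \<and>
     (\<forall>c\<in>A. \<forall>d\<in>A. \<forall>p \<in> cdom c \<inter> cdom d.
        H d p = mat_adjoint (E_transition n s c d p) * H c p * E_transition n s c d p)"

text \<open>The coefficient of $dz_c \wedge d\bar z_c$ in the curvature
  $F = \bar\partial (H^{-1} \partial H)$ of the Chern connection.\<close>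

definition chern_curvature :: "nat \<Rightarrow> ('a chart \<Rightarrow> 'a \<Rightarrow> complex mat) \<Rightarrow> 'a chart \<Rightarrow> 'a \<Rightarrow> complex mat" where
  "chern_curvature n H c p =
     - mat_ddzbar n (\<lambda>z. inverse_mat (H c (chart_inv c z)) * mat_ddz n (\<lambda>w. H c (chart_inv c w)) z)
         (coord c p)"

definition adjoint_wrt :: "complex mat \<Rightarrow> complex mat \<Rightarrow> complex mat" where
  "adjoint_wrt H M = inverse_mat H * mat_adjoint M * H"

text \<open>The harmonic metric solves $F + [\phi, \phi^{*}] = 0$, where
  $[\phi, \phi^{*}] = \phi \wedge \phi^{*} + \phi^{*} \wedge \phi$ has coefficient
  $\Phi \Phi^{*} - \Phi^{*} \Phi$. The frames $e^c_1 \wedge \dots \wedge e^c_n$ agree on overlaps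
  and trivialise $\det E$, so \<open>H\<close> induces the trivial metric on $\det E$ iff its
  Gram determinants are 1.\<close>

definition harmonic_metric ::
  "'a chart set \<Rightarrow> nat \<Rightarrow> ('a chart \<Rightarrow> 'a chart \<Rightarrow> 'a \<Rightarrow> complex) \<Rightarrow> ('a chart \<Rightarrow> 'a \<Rightarrow> complex mat) \<Rightarrow>
   ('a chart \<Rightarrow> 'a \<Rightarrow> complex mat) \<Rightarrow> bool" where
  "harmonic_metric A n s \<Phi> H \<longleftrightarrow>
     hermitian_metric A n s H \<and>
     (\<forall>c\<in>A. \<forall>p \<in> cdom c. Determinant.det (H c p) = 1) \<and>
     (\<forall>c\<in>A. \<forall>p \<in> cdom c.
        chern_curvature n H c p +
        (\<Phi> c p * adjoint_wrt (H c p) (\<Phi> c p) - adjoint_wrt (H c p) (\<Phi> c p) * \<Phi> c p) = 0\<^sub>m n n)"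

text \<open>$h_1 \oplus \dots \oplus h_n$, where \<open>h j c p\<close> is $h_j(e^c_j, e^c_j)$ at \<open>p\<close>.\<close>

definition direct_sum_metric :: "nat \<Rightarrow> (nat \<Rightarrow> 'a chart \<Rightarrow> 'a \<Rightarrow> real) \<Rightarrow> 'a chart \<Rightarrow> 'a \<Rightarrow> complex mat" where
  "direct_sum_metric n h c p = mat_diag n (\<lambda>i. of_real (h (i + 1) c p))"

section \<open>Error functions\<close>

text \<open>$h_j = (t|q|)^{-(n+1-2j)/n} e^{-\tilde u^j}$ away from the zeros of \<open>q\<close>. Both $h_j$ and
  $|q|^{-(n+1-2j)/n}$ are metrics on $K^{(n+1-2j)/2}$, so $\tilde u^j$ is a function on the surface and
  the identity may be read in any chart.\<close>

definition error_functions ::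
  "'a chart set \<Rightarrow> nat \<Rightarrow> ('a chart \<Rightarrow> 'a \<Rightarrow> complex) \<Rightarrow> real \<Rightarrow> (nat \<Rightarrow> 'a chart \<Rightarrow> 'a \<Rightarrow> real) \<Rightarrow>
   (nat \<Rightarrow> 'a \<Rightarrow> real) \<Rightarrow> bool" where
  "error_functions A n q t h u \<longleftrightarrow>
     (\<forall>j\<in>{1..n}. \<forall>c\<in>A. \<forall>p \<in> cdom c. q c p \<noteq> 0 \<longrightarrow>
        h j c p = (t * cmod (q c p)) powr (- ((real n + 1 - 2 * real j) / real n)) * exp (- u j p))"

definition zeta :: "nat \<Rightarrow> complex" where
  "zeta n = exp (2 * of_real pi * \<i> / of_nat n)"

text \<open>$d^i = \tilde u^i$ with \<open>i\<close> read in $\{1, \dots, n\}$ modulo \<open>n\<close>.\<close>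

definition cyclic_error :: "nat \<Rightarrow> (nat \<Rightarrow> 'a \<Rightarrow> real) \<Rightarrow> nat \<Rightarrow> 'a \<Rightarrow> real" where
  "cyclic_error n u i = u (if i mod n = 0 then n else i mod n)"

definition fourier_error :: "nat \<Rightarrow> (nat \<Rightarrow> 'a \<Rightarrow> real) \<Rightarrow> int \<Rightarrow> 'a \<Rightarrow> complex" where
  "fourier_error n u k p = 1 / of_real (sqrt (real n)) *
     (\<Sum>i=1..n. zeta n powi (int i * k) * of_real (cyclic_error n u i p - cyclic_error n u (i + 1) p))"

end

theory Submission
  imports Defs "HOL-Complex_Analysis.Complex_Analysis" "HOL-Real_Asymp.Real_Asymp"
begin

text \<open>
  In the coordinate \<open>z\<close> and with $T = t^{1/n}$, Hitchin's equation says that the differences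
  $c^i = d^i - d^{i+1}$ solve the cyclic Toda system
  $\Delta c^i = 4T^2(2e^{c^i} - e^{c^{i-1}} - e^{c^{i+1}})$, and everything follows from this system on
  a disk slightly larger than \<open>D\<close>.

  The excess $f = \sum_i e^{c^i} - n \ge 0$ satisfies $\Delta f \ge 4T^2f^2/n^3$, so by the
  Keller--Osserman comparison it is $O(T^{-2})$ on a smaller disk; hence the $c^i$ are uniformly
  small there.

  The Fourier modes satisfy $\Delta w_k = 4T^2|1-\zeta^k|^2(w_k + N_k)$ with $N_k$ a
  convolution power series in the $w_j$. Since $|1-\zeta^{j+k}| \le |1-\zeta^j| + |1-\zeta^k|$, bounds
  of the form $|w_k| \le M e^{-y|1-\zeta^k|}$ with $y \ge 0$ pass to $N_k$ with constant $O(M^2)$.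
  Therefore the maximum principle applies to all modes at once, with radial barriers that grow at a
  rate slightly below $2|1-\zeta^k|T$. The loss in the rate is absorbed by the larger disk,
  which also yields a spare factor $e^{-aT}$ that dominates $t^{-3/(2n)}$.
\<close>

section \<open>The Laplacian\<close>

text \<open>The bound on \<open>N_k\<close> helps only if the weighted constant \<open>M\<close> is
  already small, while the Keller--Osserman step gives smallness without a weight. Hence a
  continuity argument: once every mode is below \<open>2 * \<delta>\<close> times its barrier, the
  nonlinear term is a small relative perturbation at the point and mode with the largest quotient,
  and the maximum principle improves the factor to \<open>\<delta>\<close>. Raising the exponent
  slightly costs at most the factor 2 just gained.

  A barrier with the exact linear rate \<open>2 * freq n k * T\<close> would leave nothing to absorb
  the nonlinear term or the lower-order part of the barrier's own Laplacian. A fixed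
  \<open>\<theta> < 1\<close> creates the slack \<open>1 - \<theta>\<^sup>2\<close>, which pays for
  both; it is chosen close enough to 1 that the reduced rate over the larger radius still beats the
  full rate over \<open>R\<close>.

  The Laplacian is defined by first-order data near a point and one more derivative at it, which is
  all that an interior maximum argument needs.\<close>

definition has_grad_lap :: "(complex \<Rightarrow> real) \<Rightarrow> (complex \<Rightarrow> complex) \<Rightarrow> real \<Rightarrow> complex \<Rightarrow> bool" where
  "has_grad_lap f a L z \<longleftrightarrow>
     (\<forall>\<^sub>F w in nhds z. (f has_derivative (\<lambda>h. Re (a w * h))) (at w)) \<and>
     (\<exists>\<alpha>. (a has_derivative (\<lambda>h. \<alpha> * h + of_real (L / 2) * cnj h)) (at z))"

text \<open>In \<open>has_grad_lap\<close>, \<open>a\<close> is twice the Wirtinger derivative of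
  \<open>f\<close> in z, so df = Re(a dz). The coefficient of \<open>cnj h\<close> in the derivative
  of \<open>a\<close> is then half the Laplacian, while \<alpha> is unconstrained.\<close>

definition has_laplacian :: "(complex \<Rightarrow> real) \<Rightarrow> real \<Rightarrow> complex \<Rightarrow> bool" where
  "has_laplacian f L z \<longleftrightarrow> (\<exists>a. has_grad_lap f a L z)"

lemma has_laplacianI:
  assumes "\<forall>\<^sub>F w in nhds z. (f has_derivative (\<lambda>h. Re (a w * h))) (at w)"
    and "(a has_derivative (\<lambda>h. \<alpha> * h + of_real (L / 2) * cnj h)) (at z)"
  shows "has_laplacian f L z"
  unfolding has_laplacian_def has_grad_lap_def using assms by (intro exI conjI)

lemma isCont_imp_filterlim_nhds: "isCont f x \<Longrightarrow> filterlim f (nhds (f x)) (nhds x)"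
  by (simp add: isCont_def tendsto_at_iff_tendsto_nhds)

lemma has_laplacian_cong:
  assumes f: "has_laplacian f L z" and eq: "\<forall>\<^sub>F w in nhds z. f w = g w"
  shows "has_laplacian g L z"
proof -
  from f obtain a where a: "has_grad_lap f a L z" by (auto simp: has_laplacian_def)
  have "\<forall>\<^sub>F w in nhds z. (f has_derivative (\<lambda>h. Re (a w * h))) (at w)"
    using a by (auto simp: has_grad_lap_def)
  moreover have "\<forall>\<^sub>F w in nhds z. \<forall>\<^sub>F x in nhds w. f x = g x"
    using eq by (simp add: eventually_eventually)
  ultimately have "\<forall>\<^sub>F w in nhds z. (g has_derivative (\<lambda>h. Re (a w * h))) (at w)"
  proof eventually_elim
    case (elim w)
    have "\<forall>\<^sub>F x in at w. f x = g x"
      using elim(2) by (auto simp: eventually_at_filter elim: eventually_mono)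
    moreover have "f w = g w" using elim(2) by (rule eventually_nhds_x_imp_x)
    ultimately show ?case using elim(1) by (metis has_derivative_transform_eventually UNIV_I)
  qed
  with a show ?thesis by (auto simp: has_laplacian_def has_grad_lap_def)
qed

lemma has_laplacian_const: "has_laplacian (\<lambda>_. c) 0 z"
  unfolding has_laplacian_def has_grad_lap_def
  by (rule exI[of _ "\<lambda>_. 0"], intro conjI exI[of _ 0]) simp_all

lemma has_laplacian_add:
  assumes "has_laplacian f L z" "has_laplacian g M z"
  shows "has_laplacian (\<lambda>w. f w + g w) (L + M) z"
proof -
  from assms obtain a b \<alpha> \<beta> where
    f: "\<forall>\<^sub>F w in nhds z. (f has_derivative (\<lambda>h. Re (a w * h))) (at w)"
    and a: "(a has_derivative (\<lambda>h. \<alpha> * h + of_real (L / 2) * cnj h)) (at z)"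
    and g: "\<forall>\<^sub>F w in nhds z. (g has_derivative (\<lambda>h. Re (b w * h))) (at w)"
    and b: "(b has_derivative (\<lambda>h. \<beta> * h + of_real (M / 2) * cnj h)) (at z)"
    by (auto simp: has_laplacian_def has_grad_lap_def)
  from f g have "\<forall>\<^sub>F w in nhds z. ((\<lambda>w. f w + g w) has_derivative (\<lambda>h. Re ((a w + b w) * h))) (at w)"
  proof eventually_elim
    case (elim w)
    from has_derivative_add[OF this] show ?case by (simp add: algebra_simps)
  qed
  moreover from has_derivative_add[OF a b]
  have "((\<lambda>w. a w + b w) has_derivative (\<lambda>h. (\<alpha> + \<beta>) * h + of_real ((L + M) / 2) * cnj h)) (at z)"
    by (simp add: algebra_simps add_divide_distrib)
  ultimately show ?thesis by (rule has_laplacianI)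
qed

lemma has_laplacian_cmult:
  assumes "has_laplacian f L z"
  shows "has_laplacian (\<lambda>w. c * f w) (c * L) z"
proof -
  from assms obtain a \<alpha> where
    f: "\<forall>\<^sub>F w in nhds z. (f has_derivative (\<lambda>h. Re (a w * h))) (at w)"
    and a: "(a has_derivative (\<lambda>h. \<alpha> * h + of_real (L / 2) * cnj h)) (at z)"
    by (auto simp: has_laplacian_def has_grad_lap_def)
  from f have "\<forall>\<^sub>F w in nhds z. ((\<lambda>w. c * f w) has_derivative (\<lambda>h. Re ((of_real c * a w) * h))) (at w)"
  proof eventually_elim
    case (elim w)
    from has_derivative_mult_right[OF this, of c] show ?case by (simp add: algebra_simps)
  qed
  moreover from has_derivative_mult_right[OF a, of "of_real c"]
  have "((\<lambda>w. of_real c * a w) has_derivative (\<lambda>h. (of_real c * \<alpha>) * h + of_real ((c * L) / 2) * cnj h)) (at z)"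
    by (simp add: algebra_simps)
  ultimately show ?thesis by (rule has_laplacianI)
qed

lemma has_laplacian_diff:
  assumes "has_laplacian f L z" "has_laplacian g M z"
  shows "has_laplacian (\<lambda>w. f w - g w) (L - M) z"
  using has_laplacian_add[OF assms(1) has_laplacian_cmult[OF assms(2), of "-1"]] by simp

lemma has_laplacian_sum:
  assumes "\<And>i. i \<in> I \<Longrightarrow> has_laplacian (f i) (L i) z"
  shows "has_laplacian (\<lambda>w. \<Sum>i\<in>I. f i w) (\<Sum>i\<in>I. L i) z"
  using assms
proof (induction I rule: infinite_finite_induct)
  case (insert x F)
  then show ?case by (auto intro!: has_laplacian_add)
qed (auto intro: has_laplacian_const)

lemma has_laplacian_imp_continuous:
  assumes "has_laplacian f L z"
  shows "isCont f z"
proof -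
  from assms obtain a where "\<forall>\<^sub>F w in nhds z. (f has_derivative (\<lambda>h. Re (a w * h))) (at w)"
    by (auto simp: has_laplacian_def has_grad_lap_def)
  from eventually_nhds_x_imp_x[OF this] show ?thesis by (rule has_derivative_continuous)
qed

lemma has_grad_lap_compose_real:
  assumes f: "has_grad_lap f a L z"
    and d1: "\<forall>\<^sub>F y in nhds (f z). (G has_real_derivative G1 y) (at y)"
    and d2: "(G1 has_real_derivative G2) (at (f z))"
  shows "has_grad_lap (\<lambda>w. G (f w)) (\<lambda>w. of_real (G1 (f w)) * a w)
           (G2 * (cmod (a z))\<^sup>2 + G1 (f z) * L) z"
proof -
  from f obtain \<alpha> where
    f: "\<forall>\<^sub>F w in nhds z. (f has_derivative (\<lambda>h. Re (a w * h))) (at w)"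
    and a: "(a has_derivative (\<lambda>h. \<alpha> * h + of_real (L / 2) * cnj h)) (at z)"
    by (auto simp: has_grad_lap_def)
  note fz = eventually_nhds_x_imp_x[OF f]
  have "filterlim f (nhds (f z)) (nhds z)"
    by (rule isCont_imp_filterlim_nhds[OF has_derivative_continuous[OF fz]])
  with d1 have "\<forall>\<^sub>F w in nhds z. (G has_real_derivative G1 (f w)) (at (f w))"
    by (auto dest: eventually_compose_filterlim)
  with f have "\<forall>\<^sub>F w in nhds z. ((\<lambda>w. G (f w)) has_derivative (\<lambda>h. Re (of_real (G1 (f w)) * a w * h))) (at w)"
  proof eventually_elim
    case (elim w)
    have "(G has_derivative (\<lambda>x. G1 (f w) * x)) (at (f w))"
      using elim(2) by (simp add: has_field_derivative_def)
    from has_derivative_compose[OF elim(1) this] show ?case by (simp add: algebra_simps)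
  qed
  moreover have "((\<lambda>w. of_real (G1 (f w)) * a w) has_derivative
      (\<lambda>h. (of_real (G1 (f z)) * \<alpha> + of_real G2 * (a z)\<^sup>2 / 2) * h +
           of_real ((G2 * (cmod (a z))\<^sup>2 + G1 (f z) * L) / 2) * cnj h)) (at z)"
  proof -
    have "(G1 has_derivative (\<lambda>x. G2 * x)) (at (f z))"
      using d2 by (simp add: has_field_derivative_def)
    from has_derivative_compose[OF fz this]
    have "((\<lambda>w. of_real (G1 (f w)) :: complex) has_derivative (\<lambda>h. of_real (G2 * Re (a z * h)))) (at z)"
      by (rule has_derivative_of_real)
    from has_derivative_mult[OF this a]
    have D: "((\<lambda>w. of_real (G1 (f w)) * a w) has_derivative
        (\<lambda>h. of_real (G1 (f z)) * (\<alpha> * h + of_real (L / 2) * cnj h) +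
             of_real (G2 * Re (a z * h)) * a z)) (at z)" .
    have "of_real (G1 (f z)) * (\<alpha> * h + of_real (L / 2) * cnj h) + of_real (G2 * Re (a z * h)) * a z =
       (of_real (G1 (f z)) * \<alpha> + of_real G2 * (a z)\<^sup>2 / 2) * h +
           of_real ((G2 * (cmod (a z))\<^sup>2 + G1 (f z) * L) / 2) * cnj h" for h
    proof -
      \<comment> \<open>The part of \<open>Re (a z * h)\<close> in \<open>cnj h\<close> produces the
        squared gradient length in the Laplacian; the part in \<open>h\<close> only changes
        \<alpha>.\<close>
      have r: "of_real (Re (a z * h)) = (a z * h + cnj (a z) * cnj h) / 2"
        using complex_add_cnj[of "a z * h"] by simp
      have m: "of_real ((cmod (a z))\<^sup>2) = a z * cnj (a z)"
        by (metis complex_norm_square)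
      show ?thesis
        unfolding of_real_mult of_real_add of_real_divide r m
        by (simp add: field_simps power2_eq_square)
    qed
    then show ?thesis using D by simp
  qed
  ultimately show ?thesis by (auto simp: has_grad_lap_def)
qed

text \<open>The chain rule adds a nonnegative squared gradient, which is dropped. Subsolution
  arguments need only the inequality, so the exact value \<open>M\<close> stays abstract.\<close>

lemma has_laplacian_exp:
  assumes "has_laplacian f L z"
  obtains M where "has_laplacian (\<lambda>w. exp (f w)) M z" "M \<ge> exp (f z) * L"
proof -
  from assms obtain a where a: "has_grad_lap f a L z" by (auto simp: has_laplacian_def)
  have "has_grad_lap (\<lambda>w. exp (f w)) (\<lambda>w. of_real (exp (f w)) * a w)
           (exp (f z) * (cmod (a z))\<^sup>2 + exp (f z) * L) z"
    by (rule has_grad_lap_compose_real[OF a]) (auto intro!: derivative_eq_intros)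
  then show ?thesis by (intro that) (auto simp: has_laplacian_def)
qed

text \<open>The profile is a function of the squared modulus, which is smooth at the origin, so the
  centre of the disk needs no separate treatment.\<close>

lemma has_laplacian_radial:
  assumes d1: "\<forall>\<^sub>F y in nhds ((cmod z)\<^sup>2). (G has_real_derivative G1 y) (at y)"
    and d2: "(G1 has_real_derivative G2) (at ((cmod z)\<^sup>2))"
  shows "has_laplacian (\<lambda>w. G ((cmod w)\<^sup>2)) (4 * (cmod z)\<^sup>2 * G2 + 4 * G1 ((cmod z)\<^sup>2)) z"
proof -
  have "has_grad_lap (\<lambda>w. (cmod w)\<^sup>2) (\<lambda>w. 2 * cnj w) 4 z"
    unfolding has_grad_lap_def cmod_power2
  proof (intro conjI always_eventually allI exI[of _ 0])
    fix w
    have "((\<lambda>w. (Re w)\<^sup>2 + (Im w)\<^sup>2) has_derivative (\<lambda>h. 2 * Re w * Re h + 2 * Im w * Im h)) (at w)"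
      by (auto intro!: derivative_eq_intros)
    then show "((\<lambda>w. (Re w)\<^sup>2 + (Im w)\<^sup>2) has_derivative (\<lambda>h. Re (2 * cnj w * h))) (at w)"
      by simp
    show "((\<lambda>w. 2 * cnj w) has_derivative (\<lambda>h. 0 * h + complex_of_real (4 / 2) * cnj h)) (at z)"
      by (auto intro!: derivative_eq_intros)
  qed
  from has_grad_lap_compose_real[OF this d1 d2] show ?thesis
    by (auto simp: has_laplacian_def norm_mult power_mult_distrib algebra_simps)
qed

text \<open>The new gradient coefficient is \<open>a (\<psi> w) * deriv \<psi> w\<close>. Its second
  factor is holomorphic, so the \<open>cnj h\<close> part comes from \<open>a\<close> alone and
  picks up the derivative of \<psi> times its conjugate.\<close>

lemma has_laplacian_compose_holomorphic:
  assumes f: "has_laplacian f L (\<psi> z)" and S: "open S" "z \<in> S" and h: "\<psi> holomorphic_on S"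
  shows "has_laplacian (\<lambda>w. f (\<psi> w)) (L * (cmod (deriv \<psi> z))\<^sup>2) z"
proof -
  from f obtain a \<alpha> where
    f: "\<forall>\<^sub>F w in nhds (\<psi> z). (f has_derivative (\<lambda>h. Re (a w * h))) (at w)"
    and a: "(a has_derivative (\<lambda>h. \<alpha> * h + of_real (L / 2) * cnj h)) (at (\<psi> z))"
    by (auto simp: has_laplacian_def has_grad_lap_def)
  have D: "(\<psi> has_derivative (\<lambda>h. deriv \<psi> w * h)) (at w)" if "w \<in> S" for w
    using holomorphic_derivI[OF h S(1) that] by (simp add: has_field_derivative_def)
  have D2: "(deriv \<psi> has_derivative (\<lambda>h. deriv (deriv \<psi>) z * h)) (at z)"
    using holomorphic_derivI[OF holomorphic_deriv[OF h S(1)] S] by (simp add: has_field_derivative_def)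
  have "filterlim \<psi> (nhds (\<psi> z)) (nhds z)"
    by (rule isCont_imp_filterlim_nhds[OF has_derivative_continuous[OF D[OF S(2)]]])
  with f have "\<forall>\<^sub>F w in nhds z. (f has_derivative (\<lambda>h. Re (a (\<psi> w) * h))) (at (\<psi> w))"
    by (auto dest: eventually_compose_filterlim)
  moreover have "\<forall>\<^sub>F w in nhds z. w \<in> S" using S by (rule eventually_nhds_in_open)
  ultimately have "\<forall>\<^sub>F w in nhds z. ((\<lambda>w. f (\<psi> w)) has_derivative (\<lambda>h. Re (a (\<psi> w) * deriv \<psi> w * h))) (at w)"
  proof eventually_elim
    case (elim w)
    from has_derivative_compose[OF D[OF elim(2)] elim(1)] show ?case by (simp add: mult.assoc)
  qed
  moreover have "((\<lambda>w. a (\<psi> w) * deriv \<psi> w) has_derivative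
      (\<lambda>h. (a (\<psi> z) * deriv (deriv \<psi>) z + \<alpha> * (deriv \<psi> z)\<^sup>2) * h +
           of_real (L * (cmod (deriv \<psi> z))\<^sup>2 / 2) * cnj h)) (at z)"
  proof -
    have eq: "a (\<psi> z) * (deriv (deriv \<psi>) z * h) +
       (\<alpha> * (deriv \<psi> z * h) + of_real (L / 2) * cnj (deriv \<psi> z * h)) * deriv \<psi> z =
       (a (\<psi> z) * deriv (deriv \<psi>) z + \<alpha> * (deriv \<psi> z)\<^sup>2) * h +
           of_real (L * (cmod (deriv \<psi> z))\<^sup>2 / 2) * cnj h" for h
      unfolding of_real_mult of_real_divide complex_norm_square
      by (simp add: field_simps power2_eq_square)
    from has_derivative_mult[OF has_derivative_compose[OF D[OF S(2)] a] D2]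
    show ?thesis by (simp only: eq)
  qed
  ultimately show ?thesis by (rule has_laplacianI)
qed

text \<open>The gradient coefficient is the logarithmic derivative of \<open>F\<close>, which is
  holomorphic and has no \<open>cnj h\<close> part.\<close>

lemma has_laplacian_ln_norm_holomorphic:
  assumes "F holomorphic_on S" "open S" "z \<in> S" "F z \<noteq> 0"
  shows "has_laplacian (\<lambda>w. ln (cmod (F w))) 0 z"
proof -
  define T where "T = S \<inter> F -` (- {0})"
  have T: "open T" "z \<in> T" "F holomorphic_on T"
    using assms continuous_open_preimage[OF holomorphic_on_imp_continuous_on[OF assms(1)] assms(2), of "- {0}"]
    by (auto simp: T_def intro: holomorphic_on_subset)
  have nz: "F w \<noteq> 0" if "w \<in> T" for w using that by (auto simp: T_def)
  have "\<forall>\<^sub>F w in nhds z. ((\<lambda>w. ln (cmod (F w))) has_derivative (\<lambda>h. Re (deriv F w / F w * h))) (at w)"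
    using eventually_nhds_in_open[OF T(1,2)]
  proof eventually_elim
    case (elim w)
    have D: "(F has_derivative (\<lambda>h. deriv F w * h)) (at w)"
      using holomorphic_derivI[OF T(3,1) elim] by (simp add: has_field_derivative_def)
    have "((\<lambda>w. cmod (F w)) has_derivative (\<lambda>h. inner (deriv F w * h) (sgn (F w)))) (at w)"
      by (rule has_derivative_compose[OF D has_derivative_norm[OF nz[OF elim]]])
    from has_derivative_ln[OF _ this] nz[OF elim]
    have "((\<lambda>w. ln (cmod (F w))) has_derivative (\<lambda>h. (inner (deriv F w * h) (sgn (F w))) * inverse (cmod (F w)))) (at w)"
      by simp
    moreover have "(inner x (sgn (F w))) * inverse (cmod (F w)) = Re (x / F w)" for x
      by (simp add: inner_complex_def sgn_div_norm scaleR_conv_of_real Re_divide cmod_power2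
          divide_simps power2_eq_square[of "cmod _"] flip: cmod_power2)
    ultimately show ?case by simp
  qed
  moreover have "((\<lambda>w. deriv F w / F w) has_derivative (\<lambda>h. deriv (\<lambda>w. deriv F w / F w) z * h)) (at z)"
    using holomorphic_derivI[of "\<lambda>w. deriv F w / F w" T z] T nz
    by (auto simp: has_field_derivative_def intro!: holomorphic_intros)
  ultimately show ?thesis unfolding has_laplacian_def has_grad_lap_def
    by (intro exI[of _ "\<lambda>w. deriv F w / F w"]) auto
qed

section \<open>The maximum principle\<close>

lemma local_max_second_derivative_le:
  fixes f :: "real \<Rightarrow> real"
  assumes d1: "\<forall>\<^sub>F x in nhds 0. (f has_real_derivative f1 x) (at x)"
    and d2: "(f1 has_real_derivative f2) (at 0)"
    and max: "\<forall>\<^sub>F x in nhds 0. f x \<le> f 0"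
  shows "f2 \<le> 0"
proof (rule ccontr)
  assume "\<not> f2 \<le> 0"
  then have "f2 > 0" by simp
  have "eventually (\<lambda>x. (f has_real_derivative f1 x) (at x) \<and> f x \<le> f 0) (nhds 0)"
    using d1 max by (rule eventually_conj)
  then obtain e where e: "e > 0"
    "\<And>x. \<bar>x\<bar> < e \<Longrightarrow> (f has_real_derivative f1 x) (at x) \<and> f x \<le> f 0"
    unfolding eventually_nhds_metric by (auto simp: dist_real_def)
  have "f1 0 = 0"
    by (rule DERIV_local_max[of f _ 0 e]) (use e in auto)
  moreover from DERIV_pos_inc_right[OF d2 \<open>f2 > 0\<close>] obtain d where
    d: "d > 0" "\<And>x. 0 < x \<Longrightarrow> x < d \<Longrightarrow> f1 0 < f1 x" by auto
  define m where "m = min d e / 2"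
  have m: "m > 0" "m < d" "m < e" using d e by (auto simp: m_def)
  have "f 0 < f m"
  proof (rule DERIV_pos_imp_increasing_open[OF m(1)])
    fix x assume "0 < x" "x < m"
    then show "\<exists>y. (f has_real_derivative y) (at x) \<and> 0 < y"
      using d(2)[of x] e(2)[of x] \<open>f1 0 = 0\<close> m by (intro exI[of _ "f1 x"]) auto
  next
    show "continuous_on {0..m} f"
    proof (intro continuous_at_imp_continuous_on ballI)
      fix x assume "x \<in> {0..m}"
      with e(2)[of x] m show "isCont f x" by (auto intro: DERIV_isCont)
    qed
  qed
  with e(2)[of m] m show False by auto
qed

lemma has_laplacian_local_max:
  assumes f: "has_laplacian f L z" and max: "\<forall>\<^sub>F w in nhds z. f w \<le> f z"
  shows "L \<le> 0"
proof -
  from f obtain a \<alpha> where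
    f: "\<forall>\<^sub>F w in nhds z. (f has_derivative (\<lambda>h. Re (a w * h))) (at w)"
    and a: "(a has_derivative (\<lambda>h. \<alpha> * h + of_real (L / 2) * cnj h)) (at z)"
    by (auto simp: has_laplacian_def has_grad_lap_def)
  have le: "Re ((\<alpha> * e + of_real (L / 2) * cnj e) * e) \<le> 0" for e
  proof (rule local_max_second_derivative_le[where f = "\<lambda>t. f (z + of_real t * e)" and
        ?f1.0 = "\<lambda>t. Re (a (z + of_real t * e) * e)"])
    have D: "((\<lambda>t. z + of_real t * e) has_derivative (\<lambda>h. of_real h * e)) (at t)" for t :: real
      by (auto intro!: derivative_eq_intros)
    have fl: "filterlim (\<lambda>t. z + of_real t * e) (nhds z) (nhds (0::real))"
      using isCont_imp_filterlim_nhds[OF has_derivative_continuous[OF D[of 0]]] by simp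
    have lim: "\<forall>\<^sub>F t in nhds (0::real). Q (z + of_real t * e)" if "eventually Q (nhds z)" for Q
      using that fl by (rule eventually_compose_filterlim)
    show "\<forall>\<^sub>F t in nhds 0. f (z + of_real t * e) \<le> f (z + of_real 0 * e)"
      using lim[OF max] by simp
    from lim[OF f] show "\<forall>\<^sub>F t in nhds 0. ((\<lambda>t. f (z + of_real t * e)) has_real_derivative Re (a (z + of_real t * e) * e)) (at t)"
    proof eventually_elim
      case (elim t)
      from has_derivative_compose[OF D elim] show ?case
        unfolding has_field_derivative_def
        by (rule has_derivative_eq_rhs) (auto simp: fun_eq_iff algebra_simps)
    qed
    have "((\<lambda>t. a (z + of_real t * e)) has_derivative (\<lambda>h. \<alpha> * (of_real h * e) + of_real (L / 2) * cnj (of_real h * e))) (at 0)"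
      by (rule has_derivative_compose[OF D]) (use a in simp)
    from has_derivative_Re[OF has_derivative_mult_left[OF this, of e]]
    show "((\<lambda>t. Re (a (z + of_real t * e) * e)) has_real_derivative Re ((\<alpha> * e + of_real (L / 2) * cnj e) * e)) (at 0)"
      unfolding has_field_derivative_def
      by (rule has_derivative_eq_rhs) (auto simp: fun_eq_iff field_simps)
  qed
  \<comment> \<open>The second derivatives along 1 and i add up to \<open>L\<close>: the terms with
    \<alpha> cancel because i squared is -1.\<close>
  from le[of 1] le[of \<i>] show ?thesis by simp
qed

section \<open>The discrete Fourier transform\<close>

lemma zeta_eq_cis: "zeta n = cis (2 * pi / real n)"
  by (simp add: zeta_def cis_conv_exp mult.commute)

lemma zeta_neq_0 [simp]: "zeta n \<noteq> 0"
  by (simp add: zeta_def)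

lemma norm_zeta_powi [simp]: "cmod (zeta n powi k) = 1"
  by (simp add: norm_power_int zeta_eq_cis)

lemma zeta_powi_eq_1_iff:
  assumes "n > 0"
  shows "zeta n powi k = 1 \<longleftrightarrow> int n dvd k"
proof -
  have "zeta n powi k = cis (2 * pi * of_int k / real n)"
    by (simp add: zeta_eq_cis cis_power_int mult_ac)
  then have "zeta n powi k = exp (\<i> * of_real (2 * pi * of_int k / real n))"
    by (simp only: cis_conv_exp)
  then have "zeta n powi k = 1 \<longleftrightarrow> (\<exists>m::int. 2 * pi * of_int k / real n = of_int (2 * m) * pi)"
    by (simp only: exp_eq_1) simp
  also have "\<dots> \<longleftrightarrow> (\<exists>m::int. k = int n * m)"
  proof (rule ex_cong1)
    fix m
    have "2 * pi * of_int k / real n = of_int (2 * m) * pi \<longleftrightarrow> real_of_int k = of_int (int n * m)"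
      using assms by (auto simp: field_simps)
    then show "2 * pi * of_int k / real n = of_int (2 * m) * pi \<longleftrightarrow> k = int n * m"
      by (simp only: of_int_eq_iff)
  qed
  finally show ?thesis by (simp add: dvd_def)
qed

text \<open>With the factor 1/n instead of the unitary normalisation, pointwise products become
  convolutions without any factor.\<close>

definition dft :: "nat \<Rightarrow> (nat \<Rightarrow> real) \<Rightarrow> int \<Rightarrow> complex" where
  "dft n a k = (\<Sum>i=1..n. zeta n powi (int i * k) * of_real (a i)) / of_nat n"

text \<open>The square is the eigenvalue of the cyclic second difference on mode k, see
  \<open>freq_square\<close>; hence mode k of the linearised Toda system has rate
  \<open>2 * freq n k * T\<close>.\<close>

definition freq :: "nat \<Rightarrow> int \<Rightarrow> real" where
  "freq n k = cmod (1 - zeta n powi k)"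

lemma zeta_powi_add_multiple:
  assumes "n > 0"
  shows "zeta n powi (k + int n * l) = zeta n powi k"
  using zeta_powi_eq_1_iff[OF assms, of "int n * l"] by (simp add: power_int_add)

lemma freq_mod: "n > 0 \<Longrightarrow> freq n (k mod int n) = freq n k"
  using zeta_powi_add_multiple[of n "k mod int n" "k div int n"] by (simp add: freq_def)

lemma dft_mod: "n > 0 \<Longrightarrow> dft n a (k mod int n) = dft n a k"
proof -
  assume n: "n > 0"
  have "zeta n powi (int i * (k mod int n)) = zeta n powi (int i * k)" for i
    using zeta_powi_add_multiple[OF n, of "int i * (k mod int n)" "int i * (k div int n)"]
    by (metis mult.left_commute distrib_left mod_mult_div_eq)
  then show ?thesis by (simp add: dft_def)
qed

lemma freq_nonneg [simp]: "freq n k \<ge> 0"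
  by (simp add: freq_def)

lemma freq_pos: "n > 0 \<Longrightarrow> \<not> int n dvd k \<Longrightarrow> freq n k > 0"
  using zeta_powi_eq_1_iff[of n k] by (simp add: freq_def)

lemma freq_le_2: "freq n k \<le> 2"
  using norm_triangle_ineq4[of 1 "zeta n powi k"] by (simp add: freq_def)

lemma freq_subadditive: "freq n k \<le> freq n j + freq n (k - j)"
proof -
  have "1 - zeta n powi k = (1 - zeta n powi j) + zeta n powi j * (1 - zeta n powi (k - j))"
    by (simp add: algebra_simps flip: power_int_add)
  then have "cmod (1 - zeta n powi k) \<le> cmod (1 - zeta n powi j) + cmod (zeta n powi j * (1 - zeta n powi (k - j)))"
    by (simp only: norm_triangle_ineq)
  then show ?thesis by (simp add: freq_def norm_mult)
qed

lemma freq_square: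
  "of_real ((freq n k)\<^sup>2) = 2 - zeta n powi k - zeta n powi (- k)"
proof -
  have "cnj (zeta n powi k) = zeta n powi (- k)"
  proof -
    have "zeta n powi k * cnj (zeta n powi k) = 1"
      by (metis complex_norm_square norm_zeta_powi of_real_1 power_one)
    then show ?thesis by (simp add: power_int_minus divide_simps mult.commute)
  qed
  moreover have "zeta n powi k * zeta n powi (- k) = 1"
    by (simp flip: power_int_add)
  ultimately show ?thesis
    unfolding freq_def complex_norm_square by (simp add: algebra_simps)
qed

lemma sum_zeta_powi:
  assumes "n > 0"
  shows "(\<Sum>j<n. zeta n powi (int j * m)) = (if int n dvd m then of_nat n else 0)"
proof -
  have "zeta n powi (int j * m) = (zeta n powi m) ^ j" for j
    by (simp add: power_int_mult mult.commute[of "int j"])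
  moreover have "(zeta n powi m) ^ n = 1"
    using zeta_powi_eq_1_iff[OF assms, of "m * int n"] by (simp add: power_int_mult)
  ultimately show ?thesis
    using zeta_powi_eq_1_iff[OF assms, of m]
    by (cases "int n dvd m") (simp_all add: geometric_sum)
qed

lemma dft_inversion:
  assumes "i \<in> {1..n}"
  shows "(\<Sum>j<n. zeta n powi (- (int i * int j)) * dft n a (int j)) = of_real (a i)"
proof -
  have n: "n > 0" using assms by auto
  have "(\<Sum>j<n. zeta n powi (- (int i * int j)) * dft n a (int j)) =
     (\<Sum>j<n. \<Sum>l=1..n. zeta n powi (int j * (int l - int i)) * of_real (a l) / of_nat n)"
    by (simp add: dft_def sum_distrib_left sum_divide_distrib algebra_simps flip: power_int_add)
  also have "\<dots> = (\<Sum>l=1..n. \<Sum>j<n. zeta n powi (int j * (int l - int i)) * of_real (a l) / of_nat n)"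
    by (rule sum.swap)
  also have "\<dots> = (\<Sum>l=1..n. (\<Sum>j<n. zeta n powi (int j * (int l - int i))) * of_real (a l) / of_nat n)"
    by (simp add: sum_distrib_right sum_divide_distrib)
  also have "\<dots> = (\<Sum>l=1..n. if l = i then of_real (a l) else 0)"
  proof (rule sum.cong[OF refl])
    fix l assume l: "l \<in> {1..n}"
    have "l = i" if "int n dvd int l - int i"
    proof -
      have "\<bar>int l - int i\<bar> < \<bar>int n\<bar>" using l assms by auto
      with that show ?thesis using dvd_imp_le_int[of "int l - int i" "int n"] by linarith
    qed
    then have "int n dvd int l - int i \<longleftrightarrow> l = i" by auto
    then show "(\<Sum>j<n. zeta n powi (int j * (int l - int i))) * of_real (a l) / of_nat n =
        (if l = i then of_real (a l) else 0)"
      using n by (simp add: sum_zeta_powi)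
  qed
  also have "\<dots> = of_real (a i)" using assms by simp
  finally show ?thesis .
qed

lemma dft_mult:
  "dft n (\<lambda>i. a i * b i) k = (\<Sum>j<n. dft n a (k - int j) * dft n b (int j))"
proof -
  have "dft n (\<lambda>i. a i * b i) k =
     (\<Sum>i=1..n. \<Sum>j<n. zeta n powi (int i * (k - int j)) * of_real (a i) * dft n b (int j) / of_nat n)"
    unfolding dft_def[of n _ k] sum_divide_distrib
  proof (rule sum.cong[OF refl])
    fix i assume "i \<in> {1..n}"
    from dft_inversion[OF this, of b, symmetric]
    show "zeta n powi (int i * k) * of_real (a i * b i) / of_nat n =
       (\<Sum>j<n. zeta n powi (int i * (k - int j)) * of_real (a i) * dft n b (int j) / of_nat n)"
      by (simp add: sum_distrib_left sum_divide_distrib power_int_diff power_int_minus right_diff_distrib field_simps)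
  qed
  also have "\<dots> = (\<Sum>j<n. \<Sum>i=1..n. zeta n powi (int i * (k - int j)) * of_real (a i) * dft n b (int j) / of_nat n)"
    by (rule sum.swap)
  also have "\<dots> = (\<Sum>j<n. dft n a (k - int j) * dft n b (int j))"
    by (simp add: dft_def[of n a] sum_distrib_right sum_divide_distrib)
  finally show ?thesis .
qed

text \<open>\<open>G\<close> stands for a weight exp(-y \<open>freq n k\<close>) with y nonnegative.
  The condition on \<open>G\<close> makes the sequences with transform dominated by \<open>G\<close>
  closed under products; the factor n counts the terms of the convolution.\<close>

lemma dft_mult_le:
  assumes G: "\<And>j k. G j * G (k - j) \<le> G k"
    and a: "\<And>k. cmod (dft n a k) \<le> K * G k" and b: "\<And>k. cmod (dft n b k) \<le> L * G k"
    and "K \<ge> 0" "L \<ge> 0"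
  shows "cmod (dft n (\<lambda>i. a i * b i) k) \<le> n * K * L * G k"
proof -
  have "cmod (dft n (\<lambda>i. a i * b i) k) \<le> (\<Sum>j<n. cmod (dft n a (k - int j) * dft n b (int j)))"
    unfolding dft_mult by (rule norm_sum)
  also have "\<dots> \<le> (\<Sum>j<n. K * L * G k)"
  proof (rule sum_mono)
    fix j
    have "cmod (dft n a (k - int j) * dft n b (int j)) \<le> (K * G (k - int j)) * (L * G (int j))"
      unfolding norm_mult by (intro mult_mono a b order_trans[OF norm_ge_zero a]) auto
    also have "\<dots> = K * L * (G (int j) * G (k - int j))" by simp
    also have "\<dots> \<le> K * L * G k" using assms by (intro mult_left_mono G) auto
    finally show "cmod (dft n a (k - int j) * dft n b (int j)) \<le> K * L * G k" .
  qed
  finally show ?thesis by simp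
qed

text \<open>The induction starts at the first power: the constant sequence 1 has mode 0 equal to 1,
  and dominating it would need a lower bound on \<open>G 0\<close>.\<close>

lemma dft_power_le:
  assumes G: "\<And>j k. G j * G (k - j) \<le> G k"
    and a: "\<And>k. cmod (dft n a k) \<le> K * G k" and "K \<ge> 0"
  shows "cmod (dft n (\<lambda>i. a i ^ Suc m) k) \<le> n ^ m * K ^ Suc m * G k"
proof (induction m arbitrary: k)
  case (Suc m)
  have "cmod (dft n (\<lambda>i. a i * a i ^ Suc m) k) \<le> n * K * (real n ^ m * K ^ Suc m) * G k"
  proof (rule dft_mult_le[OF G a])
    show "cmod (dft n (\<lambda>i. a i ^ Suc m) k) \<le> real n ^ m * K ^ Suc m * G k" for k
      using Suc.IH[of k] by simp
  qed (use assms in simp_all)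
  then show ?case by (simp add: mult_ac)
qed (use a in simp)

text \<open>By \<open>dft_power_le\<close> the power series is dominated termwise by that of exp x -
  1 - x at x = n K, times G/n. Since n K is at most 1, this scalar remainder is at most x
  squared.\<close>

lemma dft_exp_remainder_le:
  assumes G: "\<And>j k. G j * G (k - j) \<le> G k" "\<And>k. G k \<ge> 0"
    and a: "\<And>k. cmod (dft n a k) \<le> K * G k" and K: "K \<ge> 0" "n * K \<le> 1" and n: "n > 0"
  shows "cmod (dft n (\<lambda>i. exp (a i) - 1 - a i) k) \<le> n * K\<^sup>2 * G k"
proof -
  have *: "(\<lambda>m. x ^ (m + 2) / fact (m + 2)) sums (exp x - 1 - x)" for x :: real
  proof -
    have "(\<lambda>m. x ^ m / fact m) sums exp x"
      using exp_converges[of x] by (simp add: divide_inverse_commute)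
    from sums_split_initial_segment[OF this, of 2] show ?thesis by (simp add: numeral_2_eq_2 diff_diff_eq)
  qed
  have "(\<lambda>m. dft n (\<lambda>i. a i ^ (m + 2) / fact (m + 2)) k) sums dft n (\<lambda>i. exp (a i) - 1 - a i) k"
    unfolding dft_def by (intro sums_divide sums_sum sums_mult sums_of_real *)
  moreover have "cmod (dft n (\<lambda>i. a i ^ (m + 2) / fact (m + 2)) k) \<le> ((n * K) ^ (m + 2) / fact (m + 2)) * (G k / n)" for m
  proof -
    have "dft n (\<lambda>i. a i ^ (m + 2) / fact (m + 2)) k = dft n (\<lambda>i. a i ^ Suc (Suc m)) k / fact (m + 2)"
      by (simp add: dft_def sum_divide_distrib field_simps)
    then have "cmod (dft n (\<lambda>i. a i ^ (m + 2) / fact (m + 2)) k) = cmod (dft n (\<lambda>i. a i ^ Suc (Suc m)) k) / fact (m + 2)"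
      by (simp add: norm_divide del: fact_Suc)
    also have "\<dots> \<le> (n ^ Suc m * K ^ Suc (Suc m) * G k) / fact (m + 2)"
      using dft_power_le[of G n a K "Suc m" k, OF G(1) a K(1)] by (intro divide_right_mono) auto
    also have "\<dots> = ((n * K) ^ (m + 2) / fact (m + 2)) * (G k / n)"
      using n by (simp add: field_simps del: fact_Suc)
    finally show ?thesis .
  qed
  moreover note sums_mult2[OF *[of "n * K"], of "G k / n"]
  ultimately have "cmod (dft n (\<lambda>i. exp (a i) - 1 - a i) k) \<le> (exp (n * K) - 1 - n * K) * (G k / n)"
    by (metis (no_types, lifting) norm_suminf_le sums_iff)
  also have "\<dots> \<le> (n * K)\<^sup>2 * (G k / n)"
    using exp_bound[of "n * K"] K G(2)[of k] n by (intro mult_right_mono) auto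
  also have "\<dots> = n * K\<^sup>2 * G k" using n by (simp add: power2_eq_square)
  finally show ?thesis .
qed

lemma dft_norm_le:
  assumes "\<And>i. i \<in> {1..n} \<Longrightarrow> \<bar>a i\<bar> \<le> B" "n > 0"
  shows "cmod (dft n a k) \<le> B"
proof -
  have "cmod (\<Sum>i=1..n. zeta n powi (int i * k) * of_real (a i)) \<le> (\<Sum>i=1..n. B)"
    by (rule order_trans[OF norm_sum sum_mono]) (use assms in \<open>auto simp: norm_mult\<close>)
  then show ?thesis using assms(2) by (simp add: dft_def norm_divide field_simps)
qed

lemma sum_periodic_shift:
  fixes f :: "nat \<Rightarrow> 'b::ab_group_add"
  assumes "\<And>i. f (i + n) = f i"
  shows "(\<Sum>i=1..n. f (i + m)) = (\<Sum>i=1..n. f i)"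
proof (induction m)
  case (Suc m)
  have "(\<Sum>i=1..n. f (i + Suc m)) + f (1 + m) = (\<Sum>i=Suc 1..Suc n. f (i + m)) + f (1 + m)"
    by (simp only: sum.shift_bounds_cl_Suc_ivl add_Suc add_Suc_right)
  also have "\<dots> = (\<Sum>i=1..Suc n. f (i + m))"
    by (subst (2) sum.atLeast_Suc_atMost) auto
  also have "\<dots> = (\<Sum>i=1..n. f (i + m)) + f (1 + m)"
    using assms[of "1 + m"] by (simp add: algebra_simps)
  finally show ?case using Suc by simp
qed simp

lemma dft_shift:
  assumes a: "\<And>i. a (i + n) = a i" and n: "n > 0"
  shows "dft n (\<lambda>i. a (i + m)) k = zeta n powi (- (int m * k)) * dft n a k"
proof -
  define f where "f i = zeta n powi (int i * k) * of_real (a i)" for i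
  have per: "f (i + n) = f i" for i
    using zeta_powi_add_multiple[OF n, of "int i * k" k] a[of i] by (simp add: f_def distrib_right)
  have "zeta n powi (int i * k) * of_real (a (i + m)) = zeta n powi (- (int m * k)) * f (i + m)" for i
    unfolding f_def mult.assoc[symmetric] by (simp add: algebra_simps flip: power_int_add)
  then have "dft n (\<lambda>i. a (i + m)) k = zeta n powi (- (int m * k)) * (\<Sum>i=1..n. f (i + m)) / of_nat n"
    by (simp add: dft_def sum_distrib_left)
  also note sum_periodic_shift[of f, OF per]
  finally show ?thesis by (simp add: dft_def f_def)
qed

lemma dft_difference_eq_0:
  assumes b: "\<And>i. b (i + n) = b i" and n: "n > 0" and k: "int n dvd k"
  shows "dft n (\<lambda>i. b i - b (i + 1)) k = 0"
proof -
  have "zeta n powi (int i * k) = 1" for i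
    using zeta_powi_eq_1_iff[OF n] k by auto
  moreover have "(\<Sum>i=1..n. b (i + 1)) = (\<Sum>i=1..n. b i)" by (rule sum_periodic_shift) (rule b)
  then have "(\<Sum>i=1..n. b i - b (i + 1)) = 0" by (simp add: sum_subtractf)
  ultimately show ?thesis by (simp add: dft_def flip: of_real_diff of_real_sum)
qed

section \<open>Cyclic differences and exponential sums\<close>

lemma sum_second_difference:
  fixes b :: "nat \<Rightarrow> real"
  assumes b: "\<And>i. b (i + n) = b i" and n: "n > 0"
  shows "(\<Sum>i=1..n. b i * (2 * b i - b (i + n - 1) - b (i + 1))) = (\<Sum>i=1..n. (b i - b (i + 1))\<^sup>2)"
proof -
  have 1: "(\<Sum>i=1..n. b (i + n - 1) * b i) = (\<Sum>i=1..n. b i * b (i + 1))"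
  proof -
    have "(\<Sum>i=1..n. b (i + n - 1) * b i) = (\<Sum>i=1..n. b (i + (n - 1)) * b (i + (n - 1) + 1))"
      using n b by (intro sum.cong) (auto simp: algebra_simps)
    also have "\<dots> = (\<Sum>i=1..n. b i * b (i + 1))"
      using b[of "Suc _"] by (intro sum_periodic_shift[of "\<lambda>i. b i * b (i + 1)"]) (simp add: b)
    finally show ?thesis .
  qed
  have 2: "(\<Sum>i=1..n. (b (i + 1))\<^sup>2) = (\<Sum>i=1..n. (b i)\<^sup>2)"
    by (rule sum_periodic_shift) (simp add: b)
  have "(\<Sum>i=1..n. b i * (2 * b i - b (i + n - 1) - b (i + 1))) =
      2 * (\<Sum>i=1..n. (b i)\<^sup>2) - (\<Sum>i=1..n. b (i + n - 1) * b i) - (\<Sum>i=1..n. b i * b (i + 1))"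
    by (simp add: algebra_simps power2_eq_square sum.distrib sum_subtractf sum_distrib_left)
  also have "\<dots> = (\<Sum>i=1..n. (b i)\<^sup>2) + (\<Sum>i=1..n. (b (i + 1))\<^sup>2) - 2 * (\<Sum>i=1..n. b i * b (i + 1))"
    unfolding 1 2 by simp
  also have "\<dots> = (\<Sum>i=1..n. (b i - b (i + 1))\<^sup>2)"
    by (simp add: algebra_simps power2_diff sum.distrib sum_subtractf sum_distrib_left)
  finally show ?thesis .
qed

lemma abs_diff_le_sum_differences:
  fixes b :: "nat \<Rightarrow> real"
  assumes "p \<in> {1..n}" "q \<in> {1..n}"
  shows "\<bar>b p - b q\<bar> \<le> (\<Sum>i=1..n. \<bar>b i - b (i + 1)\<bar>)"
  using assms
proof (induction p q rule: linorder_wlog)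
  case (le p q)
  have "\<bar>b p - b q\<bar> = \<bar>\<Sum>i=p..<q. b (Suc i) - b i\<bar>"
    using le by (subst sum_Suc_diff') auto
  also have "\<dots> \<le> (\<Sum>i=p..<q. \<bar>b i - b (i + 1)\<bar>)"
    by (rule order_trans[OF sum_abs]) (simp add: abs_minus_commute)
  also have "\<dots> \<le> (\<Sum>i=1..n. \<bar>b i - b (i + 1)\<bar>)"
    using le by (intro sum_mono2) auto
  finally show ?case .
qed (simp add: abs_minus_commute)

text \<open>As the \<open>c i\<close> sum to zero, some exponential is at least 1 and some at most
  1, so each differs from 1 by at most the total variation \<open>D\<close> around the cycle.
  Summing over i costs n, squared; Cauchy--Schwarz for \<open>D\<close> costs the third factor
  n.\<close>

lemma exp_sum_excess_square_le:
  fixes c :: "nat \<Rightarrow> real"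
  assumes "(\<Sum>i=1..n. c i) = 0" and n: "n > 0"
  shows "((\<Sum>i=1..n. exp (c i)) - n)\<^sup>2 \<le> real n ^ 3 * (\<Sum>i=1..n. (exp (c i) - exp (c (i + 1)))\<^sup>2)"
proof -
  define b where "b i = exp (c i)" for i
  define D where "D = (\<Sum>i=1..n. \<bar>b i - b (i + 1)\<bar>)"
  have "\<exists>p\<in>{1..n}. c p \<ge> 0"
    using sum_strict_mono[of "{1..n}" c "\<lambda>_. 0"] assms n by (force simp: not_le)
  then obtain p where p: "p \<in> {1..n}" "b p \<ge> 1" by (auto simp: b_def)
  have "\<exists>p\<in>{1..n}. c p \<le> 0"
    using sum_strict_mono[of "{1..n}" "\<lambda>_. 0" c] assms n by (force simp: not_le)
  then obtain q where q: "q \<in> {1..n}" "b q \<le> 1" by (auto simp: b_def)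
  have "\<bar>b i - 1\<bar> \<le> D" if "i \<in> {1..n}" for i
    using abs_diff_le_sum_differences[OF that p(1), of b] abs_diff_le_sum_differences[OF that q(1), of b] p q
    by (auto simp: D_def)
  then have "(\<Sum>i=1..n. \<bar>b i - 1\<bar>) \<le> (\<Sum>i=1..n. D)" by (intro sum_mono) auto
  then have "\<bar>\<Sum>i=1..n. b i - 1\<bar> \<le> n * D"
    using sum_abs[of "\<lambda>i. b i - 1" "{1..n}"] by (simp del: sum_abs)
  then have "\<bar>(\<Sum>i=1..n. b i) - n\<bar> \<le> n * D" by (simp add: sum_subtractf)
  then have "((\<Sum>i=1..n. b i) - n)\<^sup>2 \<le> (n * D)\<^sup>2"
    using abs_le_square_iff[of "(\<Sum>i=1..n. b i) - n" "n * D"] by linarith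
  also have "\<dots> = real n ^ 2 * D\<^sup>2" by (simp add: power_mult_distrib)
  also have "D\<^sup>2 \<le> n * (\<Sum>i=1..n. (b i - b (i + 1))\<^sup>2)"
    using Cauchy_Schwarz_ineq_sum[of "\<lambda>_. 1" "\<lambda>i. \<bar>b i - b (i + 1)\<bar>" "{1..n}"] by (simp add: D_def)
  finally show ?thesis by (simp add: b_def power_numeral_reduce mult.assoc mult_left_mono)
qed

text \<open>Each case follows from the tangent line of exp at \<open>d\<close> or
  \<open>- d\<close>. This turns a small value of exp x - 1 - x into a bound on |x|.\<close>

lemma exp_remainder_mono:
  fixes x d :: real
  assumes "0 \<le> d" "d \<le> \<bar>x\<bar>"
  shows "min (exp d - 1 - d) (exp (- d) - 1 + d) \<le> exp x - 1 - x"
proof (cases "x \<ge> 0")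
  case True
  have "exp d * (1 + (x - d)) \<le> exp d * exp (x - d)" by (intro mult_left_mono exp_ge_add_one_self) auto
  moreover have "(exp d - 1) * (x - d) \<ge> 0" using assms True by (intro mult_nonneg_nonneg) auto
  ultimately show ?thesis by (auto simp: algebra_simps simp flip: exp_add)
next
  case False
  have "exp (- d) * (1 + (x + d)) \<le> exp (- d) * exp (x + d)" by (intro mult_left_mono exp_ge_add_one_self) auto
  moreover have "(exp (- d) - 1) * (x + d) \<ge> 0" using assms False by (intro mult_nonpos_nonpos) auto
  ultimately show ?thesis by (auto simp: algebra_simps simp flip: exp_add)
qed

section \<open>Decay for the cyclic Toda system\<close>

text \<open>Comparison with a multiple of the inverse square of \<rho>^2 - |z|^2. The power -2 is
  forced by scaling: its Laplacian grows like the power -4, the square of the function. The barrier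
  is infinite on the boundary circle, so no boundary values of \<open>f\<close> enter.\<close>

lemma keller_osserman:
  fixes f :: "complex \<Rightarrow> real"
  assumes cont: "continuous_on (cball 0 \<rho>) f" and \<rho>: "\<rho> > 0" and \<kappa>: "\<kappa> > 0"
    and lap: "\<And>z. z \<in> ball 0 \<rho> \<Longrightarrow> \<exists>L. has_laplacian f L z \<and> L \<ge> \<kappa> * (f z)\<^sup>2"
    and z: "z \<in> cball 0 \<rho>"
  shows "f z * (\<rho>\<^sup>2 - (cmod z)\<^sup>2)\<^sup>2 \<le> 32 * \<rho>\<^sup>2 / \<kappa>"
proof (rule ccontr)
  assume neg: "\<not> f z * (\<rho>\<^sup>2 - (cmod z)\<^sup>2)\<^sup>2 \<le> 32 * \<rho>\<^sup>2 / \<kappa>"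
  define s where "s w = \<rho>\<^sup>2 - (cmod w)\<^sup>2" for w :: complex
  have "continuous_on (cball 0 \<rho>) (\<lambda>w. f w * (s w)\<^sup>2)"
    unfolding s_def by (intro continuous_intros cont)
  from continuous_attains_sup[OF compact_cball _ this] \<rho> obtain z0 where
    z0: "z0 \<in> cball 0 \<rho>" "\<And>w. w \<in> cball 0 \<rho> \<Longrightarrow> f w * (s w)\<^sup>2 \<le> f z0 * (s z0)\<^sup>2" by auto
  define M where "M = f z0 * (s z0)\<^sup>2"
  have M: "M > 32 * \<rho>\<^sup>2 / \<kappa>" using neg z0(2)[OF z] by (simp add: M_def s_def)
  then have Mpos: "M > 0" using \<kappa> \<rho> by (smt (verit) divide_nonneg_pos zero_le_power2)
  then have fpos: "f z0 > 0" and "s z0 \<noteq> 0" by (auto simp: M_def zero_less_mult_iff)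
  have spos: "s w > 0" if "w \<in> ball 0 \<rho>" for w
    using that \<rho> by (auto simp: s_def intro!: power_strict_mono)
  have z0b: "z0 \<in> ball 0 \<rho>" using z0(1) \<open>s z0 \<noteq> 0\<close> by (auto simp: s_def order.order_iff_strict)
  from lap[OF z0b] obtain L where L: "has_laplacian f L z0" "L \<ge> \<kappa> * (f z0)\<^sup>2" by auto
  note s0 = spos[OF z0b]
  let ?G = "\<lambda>x. inverse ((\<rho>\<^sup>2 - x)\<^sup>2)"
  let ?N = "4 * (cmod z0)\<^sup>2 * (6 / s z0 ^ 4) + 4 * (2 / s z0 ^ 3)"
  have "has_laplacian (\<lambda>w. ?G ((cmod w)\<^sup>2)) (4 * (cmod z0)\<^sup>2 * (6 / (\<rho>\<^sup>2 - (cmod z0)\<^sup>2) ^ 4) + 4 * (2 / (\<rho>\<^sup>2 - (cmod z0)\<^sup>2) ^ 3)) z0"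
  proof (rule has_laplacian_radial[where ?G1.0 = "\<lambda>y. 2 / (\<rho>\<^sup>2 - y) ^ 3"])
    have "\<forall>\<^sub>F y in nhds ((cmod z0)\<^sup>2). y \<in> {..<\<rho>\<^sup>2}"
      using s0 by (intro eventually_nhds_in_open) (auto simp: s_def)
    then show "\<forall>\<^sub>F y in nhds ((cmod z0)\<^sup>2). (?G has_real_derivative 2 / (\<rho>\<^sup>2 - y) ^ 3) (at y)"
    proof eventually_elim
      case (elim y)
      then show ?case
        by (auto intro!: derivative_eq_intros simp: divide_simps power_numeral_reduce)
    qed
    show "((\<lambda>y. 2 / (\<rho>\<^sup>2 - y) ^ 3) has_real_derivative 6 / (\<rho>\<^sup>2 - (cmod z0)\<^sup>2) ^ 4) (at ((cmod z0)\<^sup>2))"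
      using s0 by (auto intro!: derivative_eq_intros simp: s_def divide_simps power_numeral_reduce)
        (auto simp: algebra_simps)
  qed
  then have G: "has_laplacian (\<lambda>w. ?G ((cmod w)\<^sup>2)) ?N z0" by (simp add: s_def)
  \<comment> \<open>\<open>M\<close> is the maximum of f s^2, so the multiple \<open>M\<close> of
    the barrier lies above \<open>f\<close> and touches it at \<open>z0\<close>.\<close>
  have "L - M * ?N \<le> 0"
  proof (rule has_laplacian_local_max[OF has_laplacian_diff[OF L(1) has_laplacian_cmult[OF G]]])
    have "\<forall>\<^sub>F w in nhds z0. w \<in> ball 0 \<rho>" by (rule eventually_nhds_in_open[OF open_ball z0b])
    then show "\<forall>\<^sub>F w in nhds z0. f w - M * ?G ((cmod w)\<^sup>2) \<le> f z0 - M * ?G ((cmod z0)\<^sup>2)"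
    proof eventually_elim
      case (elim w)
      have "f w * (s w)\<^sup>2 \<le> M" using z0(2)[of w] elim by (auto simp: M_def)
      then have "f w \<le> M * inverse ((s w)\<^sup>2)" using spos[OF elim] by (simp add: field_simps)
      moreover have "f z0 = M * inverse ((s z0)\<^sup>2)" using s0 by (simp add: M_def field_simps)
      ultimately show ?case by (simp add: s_def)
    qed
  qed
  moreover have "?N \<le> 32 * \<rho>\<^sup>2 / s z0 ^ 4"
  proof -
    have "?N = (24 * (cmod z0)\<^sup>2 + 8 * s z0) / s z0 ^ 4"
      using s0 by (simp add: field_simps power_numeral_reduce)
    also have "\<dots> \<le> 32 * \<rho>\<^sup>2 / s z0 ^ 4"
    proof (rule divide_right_mono)
      \<comment> \<open>Both |z0|^2 and \<open>s z0\<close> are at most \<rho>^2, and 32 = 24 +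
        8.\<close>
      show "24 * (cmod z0)\<^sup>2 + 8 * s z0 \<le> 32 * \<rho>\<^sup>2"
        using s0 zero_le_power2[of \<rho>] unfolding s_def by argo
    qed simp
    finally show ?thesis .
  qed
  then have "M * ?N \<le> M * (32 * \<rho>\<^sup>2 / s z0 ^ 4)"
    using Mpos by (intro mult_left_mono) auto
  ultimately have "\<kappa> * (f z0)\<^sup>2 \<le> M * (32 * \<rho>\<^sup>2 / s z0 ^ 4)" using L(2) by linarith
  also have "\<dots> = f z0 * (32 * \<rho>\<^sup>2 / (s z0)\<^sup>2)"
    using s0 by (simp add: M_def field_simps power_numeral_reduce)
  finally have "f z0 * (\<kappa> * f z0) \<le> f z0 * (32 * \<rho>\<^sup>2 / (s z0)\<^sup>2)"
    by (simp add: power2_eq_square algebra_simps)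
  then have "\<kappa> * f z0 \<le> 32 * \<rho>\<^sup>2 / (s z0)\<^sup>2"
    using fpos by (simp only: mult_le_cancel_left_pos)
  then have "M \<le> 32 * \<rho>\<^sup>2 / \<kappa>" using s0 \<kappa> by (simp add: M_def field_simps)
  with M show False by simp
qed

text \<open>The square root p is a smooth substitute for |z|. Its gradient has length at most 1,
  giving b^2, and its Laplacian is at most 2/\<eta>, giving the lower-order term. The shift
  \<open>r\<close> only rescales.\<close>

lemma exp_sqrt_barrier:
  assumes b: "b \<ge> 0" and \<eta>: "\<eta> > 0"
  obtains L where "has_laplacian (\<lambda>w. exp (b * (sqrt ((cmod w)\<^sup>2 + \<eta>\<^sup>2) - r))) L z"
    "L \<le> (b\<^sup>2 + 2 * b / \<eta>) * exp (b * (sqrt ((cmod z)\<^sup>2 + \<eta>\<^sup>2) - r))"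
proof -
  define x where "x = (cmod z)\<^sup>2"
  define p where "p = sqrt (x + \<eta>\<^sup>2)"
  define E where "E = exp (b * (p - r))"
  have x: "x \<ge> 0" by (simp add: x_def)
  have p: "p > 0" "p\<^sup>2 = x + \<eta>\<^sup>2" "p \<ge> \<eta>"
    using x \<eta> by (auto simp: p_def add_nonneg_pos intro!: real_le_rsqrt)
  let ?G = "\<lambda>y. exp (b * (sqrt (y + \<eta>\<^sup>2) - r))"
  let ?G1 = "\<lambda>y. b / (2 * sqrt (y + \<eta>\<^sup>2)) * exp (b * (sqrt (y + \<eta>\<^sup>2) - r))"
  define G2 where "G2 = (b\<^sup>2 / (4 * p\<^sup>2) - b / (4 * p ^ 3)) * E"
  have *: "has_laplacian (\<lambda>w. ?G ((cmod w)\<^sup>2)) (4 * (cmod z)\<^sup>2 * G2 + 4 * ?G1 ((cmod z)\<^sup>2)) z"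
  proof (rule has_laplacian_radial)
    have "\<forall>\<^sub>F y in nhds ((cmod z)\<^sup>2). y \<in> {- \<eta>\<^sup>2 <..}"
      using \<eta> x by (intro eventually_nhds_in_open) (auto simp: x_def intro: less_le_trans[of _ 0])
    then show "\<forall>\<^sub>F y in nhds ((cmod z)\<^sup>2). (?G has_real_derivative ?G1 y) (at y)"
    proof eventually_elim
      case (elim y)
      then show ?case
        by (auto intro!: derivative_eq_intros simp: divide_simps)
    qed
    have "((\<lambda>y. sqrt (y + \<eta>\<^sup>2)) has_real_derivative inverse p / 2) (at x)"
      using p by (auto intro!: derivative_eq_intros simp: p_def)
    moreover have "((\<lambda>y. b / (2 * y) * exp (b * (y - r))) has_real_derivative
        (b\<^sup>2 / (2 * p) - b / (2 * p\<^sup>2)) * E) (at (sqrt (x + \<eta>\<^sup>2)))"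
      using p(1) unfolding p_def[symmetric]
      by (auto intro!: derivative_eq_intros simp: E_def divide_simps power2_eq_square)
         (auto simp: algebra_simps)
    ultimately have "(?G1 has_real_derivative (b\<^sup>2 / (2 * p) - b / (2 * p\<^sup>2)) * E * (inverse p / 2)) (at x)"
      by (rule DERIV_chain2[rotated])
    also have "(b\<^sup>2 / (2 * p) - b / (2 * p\<^sup>2)) * E * (inverse p / 2) = G2"
      using p(1) by (simp add: G2_def field_simps power_numeral_reduce)
    finally show "(?G1 has_real_derivative G2) (at ((cmod z)\<^sup>2))" by (simp add: x_def)
  qed
  have "?G1 x = b / (2 * p) * E" by (simp add: p_def E_def)
  then have "4 * (cmod z)\<^sup>2 * G2 + 4 * ?G1 ((cmod z)\<^sup>2) = 4 * x * G2 + 4 * (b / (2 * p) * E)"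
    by (simp add: x_def)
  also have "\<dots> = (b\<^sup>2 * (x / p\<^sup>2) - b * x / p ^ 3 + 2 * b / p) * E"
    using p(1) by (simp add: G2_def field_simps power_numeral_reduce)
  also have "\<dots> \<le> (b\<^sup>2 + 2 * b / \<eta>) * E"
  proof (rule mult_right_mono)
    have "p\<^sup>2 > 0" using p(1) by simp
    then have "x / p\<^sup>2 \<le> 1" by (subst divide_le_eq_1_pos) (simp_all add: p(2))
    then have "b\<^sup>2 * (x / p\<^sup>2) \<le> b\<^sup>2 * 1" by (intro mult_left_mono) auto
    moreover have "b * x / p ^ 3 \<ge> 0" using b x p by simp
    moreover have "2 * b / p \<le> 2 * b / \<eta>" using b p \<eta> by (intro divide_left_mono) auto
    ultimately show "b\<^sup>2 * (x / p\<^sup>2) - b * x / p ^ 3 + 2 * b / p \<le> b\<^sup>2 + 2 * b / \<eta>" by linarith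
  qed (simp add: E_def)
  finally show ?thesis using * by (intro that) (auto simp: E_def p_def x_def)
qed

lemma freq_lower_bound:
  assumes n: "n > 0"
  obtains \<mu> where "\<mu> > 0" "\<And>k. \<not> int n dvd k \<Longrightarrow> freq n k \<ge> \<mu>"
proof
  \<comment> \<open>The extra 1 keeps the finite set nonempty when n = 1.\<close>
  let ?A = "insert 1 (freq n ` {1..<int n})"
  show "Min ?A > 0"
    using n by (auto simp: Min_gr_iff intro!: freq_pos dest: zdvd_imp_le)
  show "freq n k \<ge> Min ?A" if "\<not> int n dvd k" for k
  proof -
    have "k mod int n \<in> {1..<int n}"
      using that n pos_mod_bound[of "int n" k] pos_mod_sign[of "int n" k]
      by (auto simp: dvd_eq_mod_eq_0 order.order_iff_strict)
    then have "freq n (k mod int n) \<in> ?A" by blast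
    then show ?thesis using n by (simp add: freq_mod del: Min_insert)
  qed
qed

text \<open>Hitchin's equation for the d^i in the coordinate z, with T the n-th root of t. The index
  \<open>i + n - 1\<close> is the cyclic predecessor written so that it stays a natural number, also
  at i = 0.\<close>

locale cyclic_toda =
  fixes n :: nat and T :: real and S :: "complex set" and d :: "nat \<Rightarrow> complex \<Rightarrow> real"
  assumes n_pos: "n > 0" and T_pos: "T > 0"
    and periodic: "d (i + n) = d i"
    and lap_d: "z \<in> S \<Longrightarrow> has_laplacian (d i)
      (4 * T\<^sup>2 * (exp (d i z - d (i + 1) z) - exp (d (i + n - 1) z - d i z))) z"
begin

definition c :: "nat \<Rightarrow> complex \<Rightarrow> real" where
  "c i z = d i z - d (i + 1) z"

text \<open>For the error functions this is w_k divided by the square root of n.\<close>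

definition W :: "int \<Rightarrow> complex \<Rightarrow> complex" where
  "W k z = dft n (\<lambda>i. c i z) k"

lemma c_periodic: "c (i + n) z = c i z"
  using periodic[of i] periodic[of "Suc i"] by (simp add: c_def)

lemma sum_c: "(\<Sum>i=1..n. c i z) = 0"
proof -
  have "(\<Sum>i=1..n. d (i + 1) z) = (\<Sum>i=1..n. d i z)"
    by (rule sum_periodic_shift[of "\<lambda>i. d i z"]) (simp add: periodic)
  then show ?thesis unfolding c_def sum_subtractf by simp
qed

lemma lap_c:
  assumes "z \<in> S"
  shows "has_laplacian (c i)
    (4 * T\<^sup>2 * (2 * exp (c i z) - exp (c (i + n - 1) z) - exp (c (i + 1) z))) z"
proof -
  have "has_laplacian (\<lambda>w. d i w - d (i + 1) w)
     (4 * T\<^sup>2 * (exp (c i z) - exp (d (i + n - 1) z - d i z)) -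
      4 * T\<^sup>2 * (exp (c (i + 1) z) - exp (d (i + 1 + n - 1) z - d (i + 1) z))) z"
    unfolding c_def by (intro has_laplacian_diff lap_d assms)
  moreover have "d (i + 1 + n - 1) = d i" using periodic[of i] by simp
  moreover have "d (i + n - 1) z - d i z = c (i + n - 1) z"
    using periodic[of i] n_pos by (simp add: c_def)
  ultimately show ?thesis by (simp add: c_def[abs_def] algebra_simps)
qed

lemma continuous_c: "z \<in> S \<Longrightarrow> isCont (c i) z"
  using lap_c has_laplacian_imp_continuous by blast

text \<open>Summing b_i times the second difference of b and summing by parts gives the sum of the
  squared differences of the b_i, where b_i = exp(c_i). \<open>exp_sum_excess_square_le\<close>
  bounds it below by the square of the excess.\<close>

lemma lap_excess:
  assumes "z \<in> S"
  defines "f \<equiv> \<lambda>z. (\<Sum>i=1..n. exp (c i z)) - n"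
  shows "\<exists>L. has_laplacian f L z \<and> L \<ge> 4 * T\<^sup>2 / n ^ 3 * (f z)\<^sup>2"
proof -
  define b where "b i = exp (c i z)" for i
  have "\<exists>M. has_laplacian (\<lambda>w. exp (c i w)) M z \<and>
      M \<ge> b i * (4 * T\<^sup>2 * (2 * b i - b (i + n - 1) - b (i + 1)))" for i
    using has_laplacian_exp[OF lap_c[OF assms(1)]] unfolding b_def by metis
  then obtain M where M: "\<And>i. has_laplacian (\<lambda>w. exp (c i w)) (M i) z"
      "\<And>i. M i \<ge> b i * (4 * T\<^sup>2 * (2 * b i - b (i + n - 1) - b (i + 1)))" by metis
  have "has_laplacian f ((\<Sum>i=1..n. M i) - 0) z"
    unfolding f_def by (intro has_laplacian_diff has_laplacian_sum M has_laplacian_const)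
  moreover have "4 * T\<^sup>2 / n ^ 3 * (f z)\<^sup>2 \<le> (\<Sum>i=1..n. M i)"
  proof -
    have "(f z)\<^sup>2 \<le> real n ^ 3 * (\<Sum>i=1..n. (b i - b (i + 1))\<^sup>2)"
      using exp_sum_excess_square_le[OF sum_c n_pos, of z] by (simp add: f_def b_def)
    then have "4 * T\<^sup>2 / n ^ 3 * (f z)\<^sup>2 \<le> 4 * T\<^sup>2 / n ^ 3 * (real n ^ 3 * (\<Sum>i=1..n. (b i - b (i + 1))\<^sup>2))"
      by (intro mult_left_mono) auto
    also have "\<dots> = 4 * T\<^sup>2 * (\<Sum>i=1..n. (b i - b (i + 1))\<^sup>2)" using n_pos by simp
    also have "\<dots> = 4 * T\<^sup>2 * (\<Sum>i=1..n. b i * (2 * b i - b (i + n - 1) - b (i + 1)))"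
      by (subst sum_second_difference) (auto simp: b_def c_periodic n_pos)
    also have "\<dots> \<le> (\<Sum>i=1..n. M i)"
      unfolding sum_distrib_left by (intro sum_mono order_trans[OF _ M(2)]) (simp add: algebra_simps)
    finally show ?thesis .
  qed
  ultimately show ?thesis by auto
qed

lemma excess_le:
  assumes S: "cball 0 \<rho> \<subseteq> S" and \<rho>: "0 < \<rho>" and z: "z \<in> cball 0 \<rho>"
  shows "((\<Sum>i=1..n. exp (c i z)) - n) * (\<rho>\<^sup>2 - (cmod z)\<^sup>2)\<^sup>2 \<le> 8 * \<rho>\<^sup>2 * n ^ 3 / T\<^sup>2"
proof -
  have "((\<Sum>i=1..n. exp (c i z)) - n) * (\<rho>\<^sup>2 - (cmod z)\<^sup>2)\<^sup>2 \<le> 32 * \<rho>\<^sup>2 / (4 * T\<^sup>2 / n ^ 3)"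
    using S T_pos n_pos \<rho> z
    by (intro keller_osserman lap_excess)
       (auto intro!: continuous_intros continuous_at_imp_continuous_on continuous_c)
  then show ?thesis by simp
qed

text \<open>The remainders are nonnegative, and they add up to the excess because the
  \<open>c i\<close> sum to zero.\<close>

lemma exp_remainder_le_excess:
  assumes "i \<in> {1..n}"
  shows "exp (c i z) - 1 - c i z \<le> (\<Sum>i=1..n. exp (c i z)) - n"
proof -
  have "exp (c i z) - 1 - c i z \<le> (\<Sum>i=1..n. exp (c i z) - 1 - c i z)"
    using assms exp_ge_add_one_self by (intro member_le_sum) (auto simp: algebra_simps)
  also have "\<dots> = (\<Sum>i=1..n. exp (c i z)) - n" by (simp add: sum_subtractf sum_c[simplified])
  finally show ?thesis .
qed

text \<open>The second difference acts on mode k as multiplication by 2 - zeta^k - zeta^(-k), the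
  square of \<open>freq n k\<close>. The factor \<open>v\<close> makes the statement real-valued and
  is later chosen as a phase.\<close>

lemma lap_W:
  assumes "z \<in> S"
  shows "has_laplacian (\<lambda>w. Re (v * W k w))
    (4 * T\<^sup>2 * (freq n k)\<^sup>2 * Re (v * dft n (\<lambda>i. exp (c i z)) k)) z"
proof -
  define b where "b i = exp (c i z)" for i
  define L where "L i = 4 * T\<^sup>2 * (2 * b i - b (i + (n - 1)) - b (i + 1))" for i
  have Re_dft: "Re (v * dft n a k) = (\<Sum>i=1..n. Re (v * zeta n powi (int i * k) / of_nat n) * a i)" for a
  proof -
    have "v * dft n a k = (\<Sum>i=1..n. (v * zeta n powi (int i * k) / of_nat n) * of_real (a i))"
      by (simp add: dft_def sum_distrib_left sum_divide_distrib mult_ac)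
    moreover have "Re (x * of_real r) = Re x * r" for x r by simp
    ultimately show ?thesis by (simp only: Re_sum)
  qed
  have "has_laplacian (c i) (L i) z" for i
    using lap_c[OF assms, of i] n_pos by (simp add: L_def b_def)
  then have "has_laplacian (\<lambda>w. Re (v * W k w)) (Re (v * dft n L k)) z"
    unfolding W_def Re_dft by (intro has_laplacian_sum has_laplacian_cmult)
  moreover have "dft n L k = of_real (4 * T\<^sup>2 * (freq n k)\<^sup>2) * dft n b k"
  proof -
    have per: "b (i + n) = b i" for i by (simp add: b_def c_periodic)
    have "zeta n powi (- (int (n - 1) * k)) = zeta n powi k"
      using zeta_powi_add_multiple[OF n_pos, of k "- k"] n_pos by (simp add: of_nat_diff algebra_simps)
    then have "dft n (\<lambda>i. b (i + (n - 1))) k = zeta n powi k * dft n b k"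
      using dft_shift[of b n "n - 1" k, OF per n_pos] by simp
    moreover have "dft n (\<lambda>i. b (i + 1)) k = zeta n powi (- k) * dft n b k"
      using dft_shift[of b n 1 k, OF per n_pos] by simp
    moreover have "dft n L k = 4 * of_real (T\<^sup>2) * (2 * dft n b k - dft n (\<lambda>i. b (i + (n - 1))) k - dft n (\<lambda>i. b (i + 1)) k)"
      by (simp add: dft_def L_def sum_distrib_left sum_subtractf sum.distrib sum_divide_distrib
          diff_divide_distrib add_divide_distrib algebra_simps)
    ultimately show ?thesis
      unfolding of_real_mult freq_square by (simp add: algebra_simps)
  qed
  moreover have "Re (v * (of_real r * x)) = r * Re (v * x)" for r x
    by (simp add: algebra_simps)
  ultimately show ?thesis unfolding b_def[abs_def] by (simp only:)
qed

lemma W_mod: "W (k mod int n) = W k"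
  using n_pos by (simp add: W_def dft_mod fun_eq_iff)

lemma W_eq_0: "int n dvd k \<Longrightarrow> W k z = 0"
proof -
  assume "int n dvd k"
  then show ?thesis
    unfolding W_def c_def using dft_difference_eq_0[of "\<lambda>i. d i z" n k] periodic n_pos by simp
qed

lemma dft_one_eq_0:
  assumes "\<not> int n dvd k"
  shows "dft n (\<lambda>i. 1) k = 0"
proof -
  have "dft n (\<lambda>i. 1) k = zeta n powi (- k) * dft n (\<lambda>i. 1) k"
    using dft_shift[of "\<lambda>_. 1" n 1 k] n_pos by simp
  moreover have "zeta n powi (- k) \<noteq> 1"
    using assms zeta_powi_eq_1_iff[OF n_pos] by simp
  ultimately show ?thesis by simp
qed

lemma continuous_W: "z \<in> S \<Longrightarrow> isCont (W k) z"
  unfolding W_def[abs_def] dft_def using n_pos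
  by (intro continuous_intros continuous_c) auto


text \<open>A touching argument. Let \<open>M\<close> be the largest quotient of a mode by its
  barrier. If \<open>M > \<delta>\<close>, it is attained inside, since the barrier is 1 on the
  boundary circle and \<open>W1\<close> holds there. At that point the Laplacian of the mode is at
  least 4 T^2 f^2 (1 - n M) times its modulus, that of the barrier at most b^2 f^2 + 2 b f/\<eta>
  times the same modulus; \<open>b \<le> 2 * \<theta> * T\<close> and
  \<open>M \<le> 2 * \<delta>\<close> then contradict \<open>small\<close>. The maximum is over all
  modes because the nonlinear term of one mode involves the others.\<close>

lemma W_improve:
  fixes \<rho> \<eta> \<theta> b \<delta> :: real
  assumes S: "cball 0 \<rho> \<subseteq> S" and \<rho>: "\<rho> > 0" and \<eta>: "\<eta> > 0" and \<theta>: "\<theta> \<ge> 0"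
    and b: "0 \<le> b" "b \<le> 2 * \<theta> * T" and \<delta>: "\<delta> > 0"
    and small: "\<And>k. \<not> int n dvd k \<Longrightarrow> 2 * n * \<delta> + \<theta>\<^sup>2 + \<theta> / (T * freq n k * \<eta>) < 1"
    and n\<delta>: "2 * n * \<delta> \<le> 1"
    and W1: "\<And>k z. z \<in> cball 0 \<rho> \<Longrightarrow> cmod (W k z) \<le> \<delta>"
    and W2: "\<And>k z. z \<in> cball 0 \<rho> \<Longrightarrow> cmod (W k z) \<le>
      2 * \<delta> * exp (b * freq n k * (sqrt ((cmod z)\<^sup>2 + \<eta>\<^sup>2) - sqrt (\<rho>\<^sup>2 + \<eta>\<^sup>2)))"
    and z: "z \<in> cball 0 \<rho>"
  shows "cmod (W k z) \<le> \<delta> * exp (b * freq n k * (sqrt ((cmod z)\<^sup>2 + \<eta>\<^sup>2) - sqrt (\<rho>\<^sup>2 + \<eta>\<^sup>2)))"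
proof (rule ccontr)
  assume neg: "\<not> ?thesis"
  define \<phi> where "\<phi> w = sqrt ((cmod w)\<^sup>2 + \<eta>\<^sup>2) - sqrt (\<rho>\<^sup>2 + \<eta>\<^sup>2)" for w :: complex
  define F where "F j w = cmod (W j w) * exp (- (b * freq n j * \<phi> w))" for j w
  have F_mod: "F (j mod int n) = F j" for j
    using n_pos by (simp add: F_def fun_eq_iff freq_mod W_mod)
  have F_iff: "cmod (W j w) \<le> m * exp (b * freq n j * \<phi> w) \<longleftrightarrow> F j w \<le> m" for j w m
    by (simp add: F_def exp_minus field_simps)
  have contF: "continuous_on (cball 0 \<rho>) (F j)" for j
    unfolding F_def[abs_def] \<phi>_def using S
    by (intro continuous_intros continuous_at_imp_continuous_on ballI continuous_W) auto
  have "\<exists>w\<in>cball 0 \<rho>. \<forall>y\<in>cball 0 \<rho>. F j y \<le> F j w" for j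
    by (rule continuous_attains_sup[OF compact_cball _ contF]) (use \<rho> in auto)
  then obtain m where m: "\<And>j. m j \<in> cball 0 \<rho>" "\<And>j y. y \<in> cball 0 \<rho> \<Longrightarrow> F j y \<le> F j (m j)"
    by metis
  \<comment> \<open>\<open>F j\<close> depends only on j modulo n, so one period yields the maximum
    over all integer modes.\<close>
  let ?A = "(\<lambda>j. F j (m j)) ` {0..<int n}"
  define M where "M = Max ?A"
  have "M \<in> ?A" unfolding M_def using n_pos by (intro Max_in) auto
  then obtain j0 where j0: "M = F j0 (m j0)" by auto
  define z0 where "z0 = m j0"
  have z0: "z0 \<in> cball 0 \<rho>" "F j0 z0 = M" using m(1) j0 by (auto simp: z0_def)
  have F_le: "F j y \<le> M" if "y \<in> cball 0 \<rho>" for j y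
  proof -
    have "F j y \<le> F (j mod int n) (m (j mod int n))"
      using m(2)[OF that, of "j mod int n"] by (simp add: F_mod)
    also have "\<dots> \<le> M" unfolding M_def using n_pos by (intro Max_ge) auto
    finally show ?thesis .
  qed
  have "M > \<delta>"
    using neg F_le[OF z, of k] F_iff[of k z \<delta>] by (simp add: \<phi>_def)
  have "M \<le> 2 * \<delta>"
    using W2[OF z0(1), of j0] F_iff[of j0 z0 "2 * \<delta>"] z0(2) by (simp add: \<phi>_def)
  define g where "g = exp (b * freq n j0 * \<phi> z0)"
  have g: "g > 0" by (simp add: g_def)
  have Wz0: "cmod (W j0 z0) = M * g"
    using z0(2) by (auto simp: F_def g_def exp_minus field_simps)
  have nd: "\<not> int n dvd j0"
    using W_eq_0[of j0 z0] Wz0 g \<open>M > \<delta>\<close> \<delta> by auto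
  define f where "f = freq n j0"
  have f: "f > 0" using freq_pos[OF n_pos nd] by (simp add: f_def)
  have "cmod z0 \<noteq> \<rho>"
    using W1[OF z0(1), of j0] \<open>M > \<delta>\<close> z0(2) by (auto simp: F_def \<phi>_def)
  then have z0b: "z0 \<in> ball 0 \<rho>" using z0(1) by auto
  \<comment> \<open>The phase that makes \<open>W j0 z0\<close> real and positive: the real part of
    \<open>v * W j0 w\<close> lies below \<open>M\<close> times the barrier and touches it at
    \<open>z0\<close>.\<close>
  define v where "v = cnj (W j0 z0) / cmod (W j0 z0)"
  have vW: "v * W j0 z0 = of_real (M * g)"
  proof -
    have "v * W j0 z0 = of_real ((cmod (W j0 z0))\<^sup>2) / of_real (cmod (W j0 z0))"
      unfolding complex_norm_square by (simp add: v_def)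
    also have "\<dots> = of_real (cmod (W j0 z0))" by (simp add: power2_eq_square)
    finally show ?thesis by (simp only: Wz0)
  qed
  have normv: "cmod v = 1"
    using Wz0 g \<open>M > \<delta>\<close> \<delta> by (simp add: v_def norm_divide norm_mult)
  from exp_sqrt_barrier[of "b * f" \<eta> "sqrt (\<rho>\<^sup>2 + \<eta>\<^sup>2)" z0] b f \<eta>
  obtain L where L: "has_laplacian (\<lambda>w. exp (b * f * \<phi> w)) L z0"
    "L \<le> ((b * f)\<^sup>2 + 2 * (b * f) / \<eta>) * g"
    by (auto simp: \<phi>_def g_def f_def)
  define X where "X = Re (v * dft n (\<lambda>i. exp (c i z0)) j0)"
  have "4 * T\<^sup>2 * f\<^sup>2 * X - M * L \<le> 0"
    unfolding X_def f_def
  proof (rule has_laplacian_local_max[OF has_laplacian_diff[OF lap_W has_laplacian_cmult]])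
    show "z0 \<in> S" using z0 S by auto
    show "has_laplacian (\<lambda>w. exp (b * f * \<phi> w)) L z0" by (rule L)
    have "\<forall>\<^sub>F w in nhds z0. w \<in> ball 0 \<rho>" by (rule eventually_nhds_in_open[OF open_ball z0b])
    then show "\<forall>\<^sub>F w in nhds z0. Re (v * W j0 w) - M * exp (b * f * \<phi> w)
        \<le> Re (v * W j0 z0) - M * exp (b * f * \<phi> z0)"
    proof eventually_elim
      case (elim w)
      have "Re (v * W j0 w) \<le> cmod (v * W j0 w)" by (rule complex_Re_le_cmod)
      also have "\<dots> = cmod (W j0 w)" by (simp add: norm_mult normv)
      also have "\<dots> \<le> M * exp (b * f * \<phi> w)"
        using F_le[of w j0] F_iff[of j0 w M] elim by (simp add: f_def)
      finally show ?case by (simp add: vW g_def f_def)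
    qed
  qed
  have "n * M \<le> 1"
  proof -
    have "n * M \<le> n * (2 * \<delta>)" using \<open>M \<le> 2 * \<delta>\<close> by (intro mult_left_mono) auto
    then show ?thesis using n\<delta> by simp
  qed
  define N where "N = dft n (\<lambda>i. exp (c i z0) - 1 - c i z0) j0"
  have \<phi>0: "\<phi> z0 \<le> 0" using z0 by (auto simp: \<phi>_def intro!: power_mono)
  have "cmod N \<le> n * M\<^sup>2 * exp (b * freq n j0 * \<phi> z0)"
    unfolding N_def
  proof (rule dft_exp_remainder_le[where G = "\<lambda>j. exp (b * freq n j * \<phi> z0)"])
    fix i j
    \<comment> \<open>As \<open>\<phi> z0\<close> is nonpositive, subadditivity of
      \<open>freq\<close> becomes the product condition on the weight.\<close>
    have "b * \<phi> z0 * (freq n i + freq n (j - i)) \<le> b * \<phi> z0 * freq n j"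
      using b \<phi>0 freq_subadditive[of n j i]
      by (intro mult_left_mono_neg) (auto simp: mult_nonneg_nonpos)
    then show "exp (b * freq n i * \<phi> z0) * exp (b * freq n (j - i) * \<phi> z0) \<le> exp (b * freq n j * \<phi> z0)"
      by (simp add: algebra_simps flip: exp_add)
    show "cmod (dft n (\<lambda>i. c i z0) j) \<le> M * exp (b * freq n j * \<phi> z0)"
      using F_le[OF z0(1), of j] F_iff[of j z0 M] by (simp add: W_def)
  qed (use \<open>n * M \<le> 1\<close> \<open>M > \<delta>\<close> \<delta> n_pos in auto)
  then have N: "cmod N \<le> n * M * (M * g)" by (simp add: g_def power2_eq_square mult_ac)
  \<comment> \<open>Constant, linear and higher-order part of exp; the constant contributes nothing
    because n does not divide \<open>j0\<close>.\<close>
  have "dft n (\<lambda>i. exp (c i z0)) j0 = dft n (\<lambda>i. 1) j0 + W j0 z0 + N"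
    unfolding N_def W_def dft_def
    by (simp add: algebra_simps sum_subtractf sum.distrib flip: add_divide_distrib diff_divide_distrib)
  then have "v * dft n (\<lambda>i. exp (c i z0)) j0 = of_real (M * g) + v * N"
    using vW dft_one_eq_0[OF nd] by (simp add: distrib_left)
  then have "X = M * g + Re (v * N)" by (simp add: X_def)
  moreover have "\<bar>Re (v * N)\<bar> \<le> cmod N"
    using abs_Re_le_cmod[of "v * N"] by (simp add: norm_mult normv)
  ultimately have "X \<ge> (1 - n * M) * (M * g)" using N by (simp add: algebra_simps)
  then have "4 * T\<^sup>2 * f\<^sup>2 * ((1 - n * M) * (M * g)) \<le> 4 * T\<^sup>2 * f\<^sup>2 * X"
    by (intro mult_left_mono) auto
  also have "\<dots> \<le> M * L" using \<open>4 * T\<^sup>2 * f\<^sup>2 * X - M * L \<le> 0\<close> by simp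
  also have "\<dots> \<le> M * (((b * f)\<^sup>2 + 2 * (b * f) / \<eta>) * g)"
    using \<open>M > \<delta>\<close> \<delta> by (intro mult_left_mono L) auto
  also have "\<dots> = ((b * f)\<^sup>2 + 2 * (b * f) / \<eta>) * (M * g)" by simp
  finally have "(4 * T\<^sup>2 * f\<^sup>2 * (1 - n * M)) * (M * g) \<le> ((b * f)\<^sup>2 + 2 * (b * f) / \<eta>) * (M * g)"
    by (simp only: mult.assoc)
  then have "4 * T\<^sup>2 * f\<^sup>2 * (1 - n * M) \<le> (b * f)\<^sup>2 + 2 * (b * f) / \<eta>"
    using g \<open>M > \<delta>\<close> \<delta> by (subst (asm) mult_le_cancel_right_pos) auto
  also have "\<dots> \<le> (2 * \<theta> * T * f)\<^sup>2 + 2 * (2 * \<theta> * T * f) / \<eta>"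
    using b f \<eta> by (intro add_mono power_mono divide_right_mono mult_left_mono mult_right_mono) auto
  also have "\<dots> = 4 * T\<^sup>2 * f\<^sup>2 * (\<theta>\<^sup>2 + \<theta> / (T * f * \<eta>))"
    using T_pos f \<eta> by (simp add: field_simps power2_eq_square)
  finally have "1 - n * M \<le> \<theta>\<^sup>2 + \<theta> / (T * f * \<eta>)"
    using T_pos f by simp
  moreover have "n * M \<le> n * (2 * \<delta>)" using \<open>M \<le> 2 * \<delta>\<close> by (intro mult_left_mono) auto
  ultimately show False using small[OF nd] by (simp add: f_def)
qed

text \<open>\<open>W_improve\<close> removes a factor 2 from a bound, so the exponent can be raised from 0 to
  \<open>2 * \<theta> * T\<close> in finitely many small steps.\<close>

lemma W_decay:
  fixes \<rho> \<eta> \<theta> \<delta> :: real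
  assumes S: "cball 0 \<rho> \<subseteq> S" and \<rho>: "\<rho> > 0" and \<eta>: "\<eta> > 0" and \<theta>: "\<theta> \<ge> 0" and \<delta>: "\<delta> > 0"
    and small: "\<And>k. \<not> int n dvd k \<Longrightarrow> 2 * n * \<delta> + \<theta>\<^sup>2 + \<theta> / (T * freq n k * \<eta>) < 1"
    and n\<delta>: "2 * n * \<delta> \<le> 1"
    and W1: "\<And>k z. z \<in> cball 0 \<rho> \<Longrightarrow> cmod (W k z) \<le> \<delta>"
    and z: "z \<in> cball 0 \<rho>"
  shows "cmod (W k z) \<le> \<delta> * exp (2 * \<theta> * T * freq n k * (sqrt ((cmod z)\<^sup>2 + \<eta>\<^sup>2) - sqrt (\<rho>\<^sup>2 + \<eta>\<^sup>2)))"
proof -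
  define \<phi> where "\<phi> w = sqrt ((cmod w)\<^sup>2 + \<eta>\<^sup>2) - sqrt (\<rho>\<^sup>2 + \<eta>\<^sup>2)" for w :: complex
  define r where "r = sqrt (\<rho>\<^sup>2 + \<eta>\<^sup>2)"
  have \<phi>: "- r \<le> \<phi> w" for w by (simp add: \<phi>_def r_def)
  have r: "r \<ge> 0" by (simp add: r_def)
  \<comment> \<open>One step changes the exponent by at most (2 \<theta> T/m) 2 r, since
    \<open>freq\<close> is at most 2 and \<phi> at least -r. This \<open>m\<close> keeps the change
    below ln 2, which is the factor 2 allowed in \<open>W_improve\<close>.\<close>
  obtain m :: nat where m: "4 * \<theta> * T * r / ln 2 < real m" "m > 0"
    using reals_Archimedean2[of "max (4 * \<theta> * T * r / ln 2) 0"] by auto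
  define b where "b j = 2 * \<theta> * T * (real j / real m)" for j
  have "cmod (W k z) \<le> \<delta> * exp (b j * freq n k * \<phi> z)" if "j \<le> m" "z \<in> cball 0 \<rho>" for j k z
    using that
  proof (induction j arbitrary: k z)
    case 0
    then show ?case using W1 by (simp add: b_def)
  next
    case (Suc j)
    show ?case unfolding \<phi>_def
    proof (rule W_improve[OF S \<rho> \<eta> \<theta> _ _ \<delta> small n\<delta> W1])
      show "0 \<le> b (Suc j)" using \<theta> T_pos by (simp add: b_def)
      show "b (Suc j) \<le> 2 * \<theta> * T"
        unfolding b_def using \<theta> T_pos Suc.prems by (intro mult_left_le) auto
      fix k :: int and w :: complex assume w: "w \<in> cball 0 \<rho>"
      have "b (Suc j) * freq n k * \<phi> w = b j * freq n k * \<phi> w + (2 * \<theta> * T / m) * (freq n k * \<phi> w)"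
        using m by (simp add: b_def field_simps)
      moreover have "- (2 * r) \<le> freq n k * \<phi> w"
      proof -
        have "freq n k * r \<le> 2 * r" using r freq_le_2 by (intro mult_right_mono)
        moreover have "freq n k * (- r) \<le> freq n k * \<phi> w" by (intro mult_left_mono \<phi>) simp
        ultimately show ?thesis by simp
      qed
      then have "(2 * \<theta> * T / m) * (- (2 * r)) \<le> (2 * \<theta> * T / m) * (freq n k * \<phi> w)"
        using \<theta> T_pos by (intro mult_left_mono) auto
      moreover have "(2 * \<theta> * T / m) * (2 * r) \<le> ln 2" using m by (simp add: field_simps)
      ultimately have "b j * freq n k * \<phi> w \<le> ln 2 + b (Suc j) * freq n k * \<phi> w" by simp
      then have "exp (b j * freq n k * \<phi> w) \<le> exp (ln 2 + b (Suc j) * freq n k * \<phi> w)" by simp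
      then have "\<delta> * exp (b j * freq n k * \<phi> w) \<le> \<delta> * (2 * exp (b (Suc j) * freq n k * \<phi> w))"
        using \<delta> by (intro mult_left_mono) (auto simp: exp_add)
      then show "cmod (W k w) \<le> 2 * \<delta> * exp (b (Suc j) * freq n k * (sqrt ((cmod w)\<^sup>2 + \<eta>\<^sup>2) - sqrt (\<rho>\<^sup>2 + \<eta>\<^sup>2)))"
        using Suc.IH[OF _ w, of k] Suc.prems by (simp add: \<phi>_def)
    qed (use Suc.prems in auto)
  qed
  from this[of m z k] z m show ?thesis by (simp add: b_def \<phi>_def)
qed

end

section \<open>Radii, constants and the resulting decay rate\<close>

lemma cyclic_toda_subset: "cyclic_toda n T S d \<Longrightarrow> S' \<subseteq> S \<Longrightarrow> cyclic_toda n T S' d"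
  by (auto simp: cyclic_toda_def)

lemma cyclic_toda_decay:
  fixes d :: "real \<Rightarrow> nat \<Rightarrow> complex \<Rightarrow> real"
  assumes n: "n > 0" and R: "0 < R" "R < R0"
    and toda: "\<And>T. T > 0 \<Longrightarrow> cyclic_toda n T (ball 0 R0) (d T)"
    and k: "\<not> int n dvd k"
  shows "\<exists>a>0. \<forall>\<^sub>F T in at_top. \<forall>z \<in> ball 0 R.
    cmod (dft n (\<lambda>i. d T i z - d T (i + 1) z) k) \<le> exp (- (2 * freq n k * T * (R - cmod z))) * exp (- a * T)"
proof -
  \<comment> \<open>Keller--Osserman is applied on the disk of radius \<open>\<rho>'\<close>; it
    gives small \<open>c i\<close> on radius \<rho>, from which the barriers start. The smoothing
    \<eta> is half the gap, so \<rho> - \<eta> still exceeds R.\<close>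
  define \<rho> where "\<rho> = (R + R0) / 2"
  define \<rho>' where "\<rho>' = (\<rho> + R0) / 2"
  define \<eta> where "\<eta> = (\<rho> - R) / 2"
  have \<rho>: "R < \<rho>" "\<rho> < \<rho>'" "\<rho>' < R0" "\<rho> > 0" "\<rho>' > 0" using R by (auto simp: \<rho>_def \<rho>'_def field_simps)
  have \<eta>: "\<eta> > 0" "\<rho> - \<eta> > R" using \<rho> by (auto simp: \<eta>_def field_simps)
  \<comment> \<open>The midpoint between 1 and R/(\<rho> - \<eta>): below 1, yet \<theta> (\<rho> -
    \<eta>) exceeds R.\<close>
  define \<theta> where "\<theta> = (1 + R / (\<rho> - \<eta>)) / 2"
  have "\<theta> * (\<rho> - \<eta>) = ((\<rho> - \<eta>) + R) / 2"
    using \<eta> R by (simp add: \<theta>_def distrib_right)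
  then have \<theta>: "0 \<le> \<theta>" "\<theta> < 1" "\<theta> * (\<rho> - \<eta>) > R"
    using \<eta> R by (auto simp: \<theta>_def)
  \<comment> \<open>Here 2 n \<delta> uses a quarter of the slack 1 - \<theta>^2; for large T the
    barrier's lower-order term uses less than half, by \<open>ev2\<close>.\<close>
  define \<delta> where "\<delta> = (1 - \<theta>\<^sup>2) / (8 * n)"
  have th2: "\<theta>\<^sup>2 < 1" using \<theta> by (simp add: power_less_one_iff abs_square_less_1)
  have \<delta>: "\<delta> > 0" "2 * n * \<delta> = (1 - \<theta>\<^sup>2) / 4" using n th2 by (auto simp: \<delta>_def field_simps)
  obtain \<mu> where \<mu>: "\<mu> > 0" "\<And>k. \<not> int n dvd k \<Longrightarrow> freq n k \<ge> \<mu>"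
    using freq_lower_bound[OF n] by metis
  \<comment> \<open>By \<open>exp_remainder_mono\<close> a lower bound for exp x - 1 - x whenever
    |x| is at least \<delta>.\<close>
  define m where "m = min (exp \<delta> - 1 - \<delta>) (exp (- \<delta>) - 1 + \<delta>)"
  have m: "m > 0"
  proof -
    have "1 + x < exp x" if "x \<noteq> 0" for x :: real
    proof (rule ccontr)
      assume "\<not> 1 + x < exp x"
      then have "exp x = 1 + x" using exp_ge_add_one_self[of x] by simp
      then have "ln (exp x) = exp x - 1" unfolding ln_exp by simp
      from ln_eq_minus_one[OF exp_gt_zero this] that show False by simp
    qed
    from this[of \<delta>] this[of "- \<delta>"] show ?thesis using \<delta>(1) by (simp add: m_def)
  qed
  define s where "s = (\<rho>'\<^sup>2 - \<rho>\<^sup>2)\<^sup>2"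
  have s: "s > 0" using \<rho> by (simp add: s_def power2_eq_iff)
  \<comment> \<open>What remains of the exponent, per unit of T, after the target rate over R - |z|
    is taken out.\<close>
  define a where "a = 2 * freq n k * (\<theta> * (\<rho> - \<eta>) - R)"
  have a: "a > 0" using freq_pos[OF n k] \<theta> by (simp add: a_def)
  have "((\<lambda>T::real. 1 / T\<^sup>2) \<longlongrightarrow> 0) at_top" by real_asymp
  from tendsto_mult_right[OF this, of "8 * \<rho>'\<^sup>2 * real n ^ 3 / s"]
  have "((\<lambda>T. 8 * \<rho>'\<^sup>2 * real n ^ 3 / T\<^sup>2 / s) \<longlongrightarrow> 0) at_top" by (simp add: mult.commute)
  from order_tendstoD(2)[OF this m]
  have ev1: "\<forall>\<^sub>F T in at_top. 8 * \<rho>'\<^sup>2 * real n ^ 3 / T\<^sup>2 / s < m" .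
  \<comment> \<open>The bound uses \<mu> in place of \<open>freq n k\<close>, so that one threshold
    for T serves all modes.\<close>
  have "((\<lambda>T::real. 1 / T) \<longlongrightarrow> 0) at_top" by real_asymp
  from tendsto_mult_right[OF this, of "\<theta> / (\<mu> * \<eta>)"]
  have "((\<lambda>T. \<theta> / (T * \<mu> * \<eta>)) \<longlongrightarrow> 0) at_top" by (simp add: mult_ac)
  from order_tendstoD(2)[OF this, of "(1 - \<theta>\<^sup>2) / 2"] th2
  have ev2: "\<forall>\<^sub>F T in at_top. \<theta> / (T * \<mu> * \<eta>) < (1 - \<theta>\<^sup>2) / 2" by simp
  have "\<forall>\<^sub>F T in at_top. \<forall>z \<in> ball 0 R.
    cmod (dft n (\<lambda>i. d T i z - d T (i + 1) z) k) \<le> exp (- (2 * freq n k * T * (R - cmod z))) * exp (- a * T)"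
    using ev1 ev2 eventually_gt_at_top[of 0]
  proof eventually_elim
    case (elim T)
    interpret cyclic_toda n T "ball 0 R0" "d T" by (rule toda) (use elim in simp)
    \<comment> \<open>A larger value would push the excess up to \<open>m\<close>, against
      \<open>excess_le\<close>; \<open>s\<close> is a lower bound for the weight there on the disk
      of radius \<rho>.\<close>
    have c_le: "\<bar>c i z\<bar> \<le> \<delta>" if "i \<in> {1..n}" "z \<in> cball 0 \<rho>" for i z
    proof (rule ccontr)
      assume "\<not> \<bar>c i z\<bar> \<le> \<delta>"
      then have "m \<le> exp (c i z) - 1 - c i z"
        using exp_remainder_mono[of \<delta> "c i z"] \<delta> by (simp add: m_def)
      also have "\<dots> \<le> (\<Sum>i=1..n. exp (c i z)) - n" by (rule exp_remainder_le_excess[OF that(1)])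
      finally have f: "m \<le> (\<Sum>i=1..n. exp (c i z)) - n" .
      have "s \<le> (\<rho>'\<^sup>2 - (cmod z)\<^sup>2)\<^sup>2"
        unfolding s_def using that(2) \<rho> by (intro power_mono diff_mono) auto
      then have "m * s \<le> ((\<Sum>i=1..n. exp (c i z)) - n) * (\<rho>'\<^sup>2 - (cmod z)\<^sup>2)\<^sup>2"
        using f m s by (intro mult_mono) auto
      also have "\<dots> \<le> 8 * \<rho>'\<^sup>2 * n ^ 3 / T\<^sup>2"
        using \<rho> that(2) by (intro excess_le) auto
      also have "\<dots> < m * s" using elim(1) s by (simp only: pos_divide_less_eq of_nat_power)
      finally show False by simp
    qed
    show ?case
    proof
      fix z :: complex assume z: "z \<in> ball 0 R"
      have "cmod (W k z) \<le> \<delta> * exp (2 * \<theta> * T * freq n k * (sqrt ((cmod z)\<^sup>2 + \<eta>\<^sup>2) - sqrt (\<rho>\<^sup>2 + \<eta>\<^sup>2)))"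
      proof (rule W_decay)
        show "cball 0 \<rho> \<subseteq> ball 0 R0" using \<rho> by auto
        show "2 * n * \<delta> \<le> 1" using \<delta>(2) zero_le_power2[of \<theta>] by argo
        show "z \<in> cball 0 \<rho>" using z \<rho> by auto
        show "cmod (W k z) \<le> \<delta>" if "z \<in> cball 0 \<rho>" for k z
          unfolding W_def using c_le that n by (intro dft_norm_le) auto
        show "2 * n * \<delta> + \<theta>\<^sup>2 + \<theta> / (T * freq n k * \<eta>) < 1" if "\<not> int n dvd k" for k
        proof -
          have "\<theta> / (T * freq n k * \<eta>) \<le> \<theta> / (T * \<mu> * \<eta>)"
            using \<mu>(2)[OF that] \<mu>(1) \<theta> \<eta> elim(3)
            by (intro divide_left_mono mult_right_mono mult_left_mono) auto
          then show ?thesis using elim(2) \<delta>(2) th2 by simp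
        qed
      qed (use \<rho> \<eta> \<theta> \<delta> in auto)
      also have "\<dots> \<le> 1 * exp (- (2 * freq n k * T * (R - cmod z)) + (- a * T))"
      proof (rule mult_mono)
        \<comment> \<open>The first root is at most |z| + \<eta>, the second at least
          \<rho>.\<close>
        have "sqrt ((cmod z)\<^sup>2 + \<eta>\<^sup>2) - sqrt (\<rho>\<^sup>2 + \<eta>\<^sup>2) \<le> cmod z + \<eta> - \<rho>"
          using sqrt_sum_squares_le_sum[of "cmod z" \<eta>] real_sqrt_sum_squares_ge1[of \<rho> \<eta>] \<eta>(1)
            norm_ge_zero[of z] by argo
        then have "\<theta> * (sqrt ((cmod z)\<^sup>2 + \<eta>\<^sup>2) - sqrt (\<rho>\<^sup>2 + \<eta>\<^sup>2)) \<le> \<theta> * (cmod z + \<eta> - \<rho>)"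
          using \<theta> by (intro mult_left_mono)
        also have "\<dots> \<le> - (R - cmod z) - (\<theta> * (\<rho> - \<eta>) - R)"
          using mult_right_mono[of \<theta> 1 "cmod z"] \<theta> by (simp add: algebra_simps)
        finally have "2 * T * freq n k * (\<theta> * (sqrt ((cmod z)\<^sup>2 + \<eta>\<^sup>2) - sqrt (\<rho>\<^sup>2 + \<eta>\<^sup>2)))
            \<le> 2 * T * freq n k * (- (R - cmod z) - (\<theta> * (\<rho> - \<eta>) - R))"
          using elim by (intro mult_left_mono) auto
        then show "exp (2 * \<theta> * T * freq n k * (sqrt ((cmod z)\<^sup>2 + \<eta>\<^sup>2) - sqrt (\<rho>\<^sup>2 + \<eta>\<^sup>2)))
            \<le> exp (- (2 * freq n k * T * (R - cmod z)) + (- a * T))"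
          by (simp add: a_def algebra_simps)
        have "\<delta> * 1 \<le> \<delta> * (2 * n)" using \<delta> n by (intro mult_left_mono) auto
        also have "\<delta> * (2 * n) = (1 - \<theta>\<^sup>2) / 4" using \<delta>(2) by (simp only: mult_ac)
        also have "\<dots> \<le> 1" using zero_le_power2[of \<theta>] by argo
        finally show "\<delta> \<le> 1" by simp
      qed (use \<delta> in auto)
      finally show "cmod (dft n (\<lambda>i. d T i z - d T (i + 1) z) k) \<le>
          exp (- (2 * freq n k * T * (R - cmod z))) * exp (- a * T)"
        by (simp only: W_def c_def exp_add mult_1)
    qed
  qed
  with a show ?thesis by blast
qed

section \<open>From the harmonic metric to the Toda system\<close>

lemma frechet_derivative_cong_open:
  assumes "open S" "x \<in> S" "\<And>y. y \<in> S \<Longrightarrow> f y = g y" "f differentiable at x"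
  shows "frechet_derivative g (at x) = frechet_derivative f (at x)"
proof -
  have "(f has_derivative frechet_derivative f (at x)) (at x)"
    using assms(4) frechet_derivative_works by blast
  then have "(g has_derivative frechet_derivative f (at x)) (at x)"
    by (rule has_derivative_transform_within_open[OF _ assms(1-3)])
  then show ?thesis by (rule frechet_derivative_at[symmetric])
qed

lemma Ck_on_subset: "Ck_on k S f \<Longrightarrow> T \<subseteq> S \<Longrightarrow> Ck_on k T f"
  by (induction k arbitrary: f) (auto intro: continuous_on_subset differentiable_on_subset)

lemma smooth_on_subset: "smooth_on S f \<Longrightarrow> T \<subseteq> S \<Longrightarrow> smooth_on T f"
  by (metis smooth_on_def Ck_on_subset)

lemma linear_complex_decomp:
  fixes D :: "complex \<Rightarrow> complex"
  assumes "linear D"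
  shows "D h = (D 1 - \<i> * D \<i>) / 2 * h + (D 1 + \<i> * D \<i>) / 2 * cnj h"
proof -
  have "h = Re h *\<^sub>R 1 + Im h *\<^sub>R \<i>" by (simp add: complex_eq_iff)
  then have "D h = D (Re h *\<^sub>R 1 + Im h *\<^sub>R \<i>)" by simp
  also have "\<dots> = Re h *\<^sub>R D 1 + Im h *\<^sub>R D \<i>"
    using assms by (simp add: linear_add linear_scale)
  finally show ?thesis by (simp add: complex_eq_iff field_simps)
qed

text \<open>\<open>G\<close> has the shape of a diagonal entry of H^(-1) dH/dz, namely the
  z-derivative of ln f. Doubling it gives the gradient coefficient, and the Laplacian is four times
  its zbar-derivative.\<close>

lemma has_laplacian_ln_smooth:
  fixes f :: "complex \<Rightarrow> real"
  assumes S: "open S" and sm: "smooth_on S (\<lambda>w. complex_of_real (f w))"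
    and pos: "\<And>w. w \<in> S \<Longrightarrow> f w > 0" and z: "z \<in> S"
    and G: "\<And>w. w \<in> S \<Longrightarrow> G w = of_real (1 / f w) * ddz (\<lambda>w. of_real (f w)) w"
    and b: "ddzbar G z = of_real b"
  shows "has_laplacian (\<lambda>w. ln (f w)) (4 * b) z"
proof -
  define F where "F w = complex_of_real (f w)" for w
  define fx where "fx w = frechet_derivative F (at w) 1" for w
  define fy where "fy w = frechet_derivative F (at w) \<i>" for w
  have "Ck_on (Suc (Suc 0)) S F" using sm unfolding smooth_on_def F_def[abs_def] by blast
  then have "F differentiable_on S" "fx differentiable_on S" "fy differentiable_on S"
    by (auto simp: fx_def[abs_def] fy_def[abs_def])
  then have dF: "F differentiable at w" and dfx: "fx differentiable at w" and dfy: "fy differentiable at w"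
    if "w \<in> S" for w
    using S that by (auto simp: differentiable_on_eq_differentiable_at)
  define G' where "G' w = of_real (1 / f w) * ddz F w" for w
  have ddzF: "ddz F w = (fx w - \<i> * fy w) / 2" for w by (simp add: ddz_def fx_def fy_def)
  have "((\<lambda>w. ln (f w)) has_derivative (\<lambda>h. Re (2 * G' w * h))) (at w)" if w: "w \<in> S" for w
  proof -
    let ?D = "frechet_derivative F (at w)"
    have D: "(F has_derivative ?D) (at w)"
      using dF[OF w] frechet_derivative_works by blast
    from has_derivative_Re[OF this] have f: "(f has_derivative (\<lambda>h. Re (?D h))) (at w)"
      by (simp add: F_def)
    from has_derivative_of_real[OF this] have "(F has_derivative (\<lambda>h. of_real (Re (?D h)))) (at w)"
      by (simp add: F_def[abs_def])
    \<comment> \<open>\<open>F\<close> is real-valued, hence so is its derivative, and the Wirtinger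
      coefficients are conjugate to each other.\<close>
    from frechet_derivative_at[OF this] have real: "Im (?D h) = 0" for h
      by (metis Im_complex_of_real)
    have "Re (?D h) = Re (2 * ddz F w * h)" for h
      using linear_complex_decomp[OF has_derivative_linear[OF D], of h] real[of 1] real[of \<i>]
      by (simp add: ddz_def)
    with has_derivative_ln[OF pos[OF w] f]
    have "((\<lambda>w. ln (f w)) has_derivative (\<lambda>h. Re (2 * ddz F w * h) * inverse (f w))) (at w)" by simp
    moreover have "Re (2 * ddz F w * h) * inverse (f w) = Re (2 * G' w * h)" for h
    proof -
      have "2 * G' w * h = of_real (inverse (f w)) * (2 * ddz F w * h)"
        by (simp add: G'_def divide_inverse mult_ac)
      then have "Re (2 * G' w * h) = Re (of_real (inverse (f w)) * (2 * ddz F w * h))"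
        by (simp only:)
      also have "Re (of_real r * x) = r * Re x" for r x by simp
      finally show ?thesis by (simp only: mult.commute)
    qed
    ultimately show ?thesis by (simp only:)
  qed
  then have "\<forall>\<^sub>F w in nhds z. ((\<lambda>w. ln (f w)) has_derivative (\<lambda>h. Re (2 * G' w * h))) (at w)"
    using eventually_nhds_in_open[OF S z] by (auto elim: eventually_mono)
  moreover have "((\<lambda>w. 2 * G' w) has_derivative
     (\<lambda>h. (2 * ddz G' z) * h + of_real (4 * b / 2) * cnj h)) (at z)"
  proof -
    have "F z \<noteq> 0" using pos[OF z] by (simp add: F_def)
    have "G' = (\<lambda>w. inverse (F w) * ((fx w - \<i> * fy w) / 2))"
      by (simp add: G'_def ddzF F_def fun_eq_iff inverse_eq_divide)
    then have dG: "G' differentiable at z"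
      using dF[OF z] dfx[OF z] dfy[OF z] \<open>F z \<noteq> 0\<close> by (auto intro!: derivative_intros)
    then have D: "(G' has_derivative frechet_derivative G' (at z)) (at z)"
      using frechet_derivative_works by blast
    have "frechet_derivative G (at z) = frechet_derivative G' (at z)"
      by (rule frechet_derivative_cong_open[OF S z _ dG]) (simp add: G G'_def F_def[abs_def])
    then have "ddzbar G' z = of_real b" using b by (simp add: ddzbar_def)
    then have "frechet_derivative G' (at z) h = ddz G' z * h + of_real b * cnj h" for h
      using linear_complex_decomp[OF has_derivative_linear[OF D], of h]
      by (simp add: ddz_def ddzbar_def)
    with has_derivative_mult_right[OF D, of 2] show ?thesis by (simp add: algebra_simps)
  qed
  ultimately show ?thesis by (rule has_laplacianI)
qed

section \<open>Diagonal metrics and the Higgs field\<close>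

lemma inverse_mat_diag:
  assumes "\<And>i. i < n \<Longrightarrow> f i \<noteq> 0"
  shows "inverse_mat (mat_diag n f) = mat_diag n (\<lambda>i. 1 / f i)"
proof -
  let ?A = "mat_diag n f" and ?B = "mat_diag n (\<lambda>i. 1 / f i)"
  have AB: "?A * ?B = 1\<^sub>m n"
    using assms by (subst mat_diag_diag) (auto simp: mat_diag_def)
  have "Determinant.det ?A * Determinant.det ?B = 1"
    using det_mult[of ?A n ?B] AB by simp
  then have d: "Determinant.det ?A \<noteq> 0" by auto
  note adj = adj_mat[of ?A n, OF mat_diag_dim]
  have "adj_mat ?A = adj_mat ?A * (?A * ?B)" by (simp only: AB right_mult_one_mat[OF adj(1)])
  also have "\<dots> = (adj_mat ?A * ?A) * ?B"
    by (rule assoc_mult_mat[OF adj(1) mat_diag_dim mat_diag_dim, symmetric])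
  also have "\<dots> = Determinant.det ?A \<cdot>\<^sub>m ?B"
    unfolding adj(3) by (subst mult_smult_assoc_mat[of _ n n _ n]) (auto simp: left_mult_one_mat[OF mat_diag_dim])
  finally show ?thesis
    unfolding inverse_mat_def using d by (intro eq_matI) (auto simp: mat_diag_def)
qed

lemma mat_adjoint_index:
  assumes "M \<in> carrier_mat n n" "i < n" "j < n"
  shows "mat_adjoint M $$ (i, j) = conjugate (M $$ (j, i))"
  using assms unfolding mat_adjoint_def by (simp add: mat_of_rows_def)

text \<open>\<Phi> is a weighted cyclic shift, so every row and column has a single entry that can
  be nonzero. The i-th diagonal entries of the two products see the arrow into and the arrow out of
  position i; the arrow from n - 1 back to 0 carries the weight Q^2.\<close>

lemma higgs_commutator_diag:
  fixes f :: "nat \<Rightarrow> real" and q :: "'a chart \<Rightarrow> 'a \<Rightarrow> complex" and c :: "'a chart" and p :: 'a and t :: real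
  assumes n: "n \<ge> 2" and i: "i < n" and f: "\<And>i. i < n \<Longrightarrow> f i > 0" and t: "t > 0"
  defines "\<Phi> \<equiv> higgs_field n t q c p" and "H \<equiv> mat_diag n (\<lambda>i. complex_of_real (f i))"
  defines "Q \<equiv> t * cmod (q c p)"
  shows "(\<Phi> * adjoint_wrt H \<Phi> - adjoint_wrt H \<Phi> * \<Phi>) $$ (i, i) =
    of_real ((if i = 0 then Q\<^sup>2 * f 0 / f (n - 1) else f i / f (i - 1)) -
      (if i = n - 1 then Q\<^sup>2 * f 0 / f (n - 1) else f (i + 1) / f i))"
proof -
  have \<Phi>: "\<Phi> \<in> carrier_mat n n" by (simp add: \<Phi>_def higgs_field_def)
  have \<Phi>a: "mat_adjoint \<Phi> \<in> carrier_mat n n"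
    using \<Phi> by (auto simp: mat_adjoint_def)
  have adj: "adjoint_wrt H \<Phi> = Matrix.mat n n (\<lambda>(i, j). of_real (f j / f i) * cnj (\<Phi> $$ (j, i)))"
  proof -
    have "inverse_mat H = mat_diag n (\<lambda>i. 1 / complex_of_real (f i))"
      unfolding H_def using f by (intro inverse_mat_diag) force
    then have "adjoint_wrt H \<Phi> = (mat_diag n (\<lambda>i. 1 / complex_of_real (f i)) * mat_adjoint \<Phi>) * H"
      by (simp add: adjoint_wrt_def)
    also have "\<dots> = Matrix.mat n n (\<lambda>(i, j). of_real (f j / f i) * cnj (\<Phi> $$ (j, i)))"
      unfolding H_def
      by (rule eq_matI) (auto simp: mat_diag_mult_left[OF \<Phi>a] mat_diag_mult_right[of _ n n]
          mat_adjoint_index[OF \<Phi>])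
    finally show ?thesis .
  qed
  have sq: "\<Phi> $$ (i, j) * cnj (\<Phi> $$ (i, j)) =
      of_real (if i = j + 1 then 1 else if i = 0 \<and> j = n - 1 then Q\<^sup>2 else 0)" if "i < n" "j < n" for i j
    using that t by (auto simp: \<Phi>_def higgs_field_def Q_def norm_mult power_mult_distrib
        power2_eq_square simp flip: complex_norm_square)
  have "(\<Phi> * adjoint_wrt H \<Phi>) $$ (i, i) = (\<Sum>j = 0..<n. of_real (f i / f j) * (\<Phi> $$ (i, j) * cnj (\<Phi> $$ (i, j))))"
    using \<Phi> i unfolding adj by (auto simp: scalar_prod_def mult_ac intro!: sum.cong)
  also have "\<dots> = (\<Sum>j = 0..<n. of_real (if j = (if i = 0 then n - 1 else i - 1)
      then (if i = 0 then Q\<^sup>2 * f 0 / f (n - 1) else f i / f (i - 1)) else 0))"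
    using i n by (intro sum.cong refl) (auto simp: sq)
  also have "\<dots> = of_real (if i = 0 then Q\<^sup>2 * f 0 / f (n - 1) else f i / f (i - 1))"
    using i n by (subst of_real_sum[symmetric], subst sum.delta) auto
  finally have 1: "(\<Phi> * adjoint_wrt H \<Phi>) $$ (i, i) = \<dots>" .
  have "(adjoint_wrt H \<Phi> * \<Phi>) $$ (i, i) = (\<Sum>j = 0..<n. of_real (f j / f i) * (\<Phi> $$ (j, i) * cnj (\<Phi> $$ (j, i))))"
    using \<Phi> i unfolding adj by (auto simp: scalar_prod_def mult_ac intro!: sum.cong)
  also have "\<dots> = (\<Sum>j = 0..<n. of_real (if j = (if i = n - 1 then 0 else i + 1)
      then (if i = n - 1 then Q\<^sup>2 * f 0 / f (n - 1) else f (i + 1) / f i) else 0))"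
    using i n by (intro sum.cong refl) (auto simp: sq)
  also have "\<dots> = of_real (if i = n - 1 then Q\<^sup>2 * f 0 / f (n - 1) else f (i + 1) / f i)"
    using i n by (subst of_real_sum[symmetric], subst sum.delta) auto
  finally have 2: "(adjoint_wrt H \<Phi> * \<Phi>) $$ (i, i) = \<dots>" .
  have c2: "adjoint_wrt H \<Phi> * \<Phi> \<in> carrier_mat n n"
    using \<Phi> unfolding adj by auto
  have "(\<Phi> * adjoint_wrt H \<Phi> - adjoint_wrt H \<Phi> * \<Phi>) $$ (i, i) =
      (\<Phi> * adjoint_wrt H \<Phi>) $$ (i, i) - (adjoint_wrt H \<Phi> * \<Phi>) $$ (i, i)"
    using i c2 by (intro index_minus_mat) auto
  then show ?thesis unfolding 1 2 of_real_diff .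
qed

section \<open>Charts and coordinate changes\<close>

lemma chart_inv_coord:
  assumes "complex_chart X c" "p \<in> cdom c"
  shows "chart_inv c (coord c p) = p"
proof -
  have "cdom c \<subseteq> topspace X" using assms(1) openin_subset by (auto simp: complex_chart_def)
  then have "inj_on (coord c) (cdom c)"
    using assms(1) homeomorphic_imp_injective_map[of "subtopology X (cdom c)"]
    by (auto simp: complex_chart_def Int_absorb1)
  then show ?thesis using assms(2) by (simp add: chart_inv_def)
qed

lemma coord_chart_inv: "x \<in> coord c ` cdom c \<Longrightarrow> coord c (chart_inv c x) = x"
  and chart_inv_in_cdom: "x \<in> coord c ` cdom c \<Longrightarrow> chart_inv c x \<in> cdom c"
  by (auto simp: chart_inv_def intro: f_inv_into_f inv_into_into)

lemma open_coord_image: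
  assumes c: "complex_chart X c" and U: "openin X U"
  shows "open (coord c ` (cdom c \<inter> U))"
proof -
  have "openin (subtopology X (cdom c)) (cdom c \<inter> U)"
    using U by (auto simp: openin_subtopology Int_commute)
  then have "openin (top_of_set (coord c ` cdom c)) (coord c ` (cdom c \<inter> U))"
    using c homeomorphic_imp_open_map[of "subtopology X (cdom c)"] unfolding complex_chart_def open_map_def by blast
  then show ?thesis using c by (auto simp: complex_chart_def intro: openin_open_trans)
qed

lemma dcoord_inverse:
  assumes c: "complex_chart X c" and z: "complex_chart X z" and comp: "compatible c z"
    and p: "p \<in> cdom c" "p \<in> cdom z"
  shows "deriv (transition z c) (coord z p) * dcoord c z p = 1"
proof -
  define V where "V = coord z ` (cdom z \<inter> cdom c)"
  define V' where "V' = coord c ` (cdom c \<inter> cdom z)"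
  have open_: "open V" "open V'"
    unfolding V_def V'_def using open_coord_image[OF z] open_coord_image[OF c] c z
    by (auto simp: complex_chart_def)
  have hol: "transition z c holomorphic_on V" "transition c z holomorphic_on V'"
    using comp by (auto simp: compatible_def V_def V'_def Int_commute)
  have zp: "coord z p \<in> V" and cp: "coord c p \<in> V'" using p by (auto simp: V_def V'_def)
  have eq: "transition z c (coord z p) = coord c p"
    using p chart_inv_coord[OF z] by (simp add: transition_def)
  have "((transition c z \<circ> transition z c) has_field_derivative
      deriv (transition c z) (coord c p) * deriv (transition z c) (coord z p)) (at (coord z p))"
    using holomorphic_derivI[OF hol(1) open_(1) zp] holomorphic_derivI[OF hol(2) open_(2) cp]
    by (intro DERIV_chain) (auto simp: eq)
  then have "((\<lambda>x. x) has_field_derivative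
      deriv (transition c z) (coord c p) * deriv (transition z c) (coord z p)) (at (coord z p))"
  proof (rule has_field_derivative_transform_within_open[OF _ open_(1) zp])
    fix x assume "x \<in> V"
    then show "(transition c z \<circ> transition z c) x = x"
      using chart_inv_coord[OF z] chart_inv_coord[OF c] by (auto simp: transition_def V_def)
  qed
  from DERIV_unique[OF this DERIV_ident] show ?thesis by (simp add: dcoord_def mult.commute)
qed


text \<open>The diagonal entry of Hitchin's equation. For a diagonal metric the curvature entry is
  minus a quarter of the Laplacian of the logarithm, so the equation equates that quarter with the
  commutator entry.\<close>

lemma higgs_log_laplacian:
  fixes f :: "nat \<Rightarrow> 'a chart \<Rightarrow> 'a \<Rightarrow> real" and q :: "'a chart \<Rightarrow> 'a \<Rightarrow> complex" and t :: real
  assumes c: "c \<in> A" "complex_chart X c" and n: "n \<ge> 2" and i: "i < n" and t: "t > 0"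
    and harm: "harmonic_metric A n s (higgs_field n t q) (direct_sum_metric n f)"
    and S: "open S" "S \<subseteq> coord c ` cdom c" and x: "x \<in> S"
    and pos: "\<And>j w. j \<in> {1..n} \<Longrightarrow> w \<in> S \<Longrightarrow> f j c (chart_inv c w) > 0"
  defines "F \<equiv> \<lambda>j. f (j + 1) c (chart_inv c x)" and "Q \<equiv> t * cmod (q c (chart_inv c x))"
  shows "has_laplacian (\<lambda>w. ln (f (i + 1) c (chart_inv c w)))
    (4 * ((if i = 0 then Q\<^sup>2 * F 0 / F (n - 1) else F i / F (i - 1)) -
      (if i = n - 1 then Q\<^sup>2 * F 0 / F (n - 1) else F (i + 1) / F i))) x"
proof -
  define H where "H = direct_sum_metric n f"
  define G where "G w = (inverse_mat (H c (chart_inv c w)) *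
    mat_ddz n (\<lambda>w. H c (chart_inv c w)) w) $$ (i, i)" for w
  define p where "p = chart_inv c x"
  have p: "p \<in> cdom c" "coord c p = x"
    using x S coord_chart_inv[of x c] chart_inv_in_cdom[of x c] by (auto simp: p_def)
  have H_diag: "H c y = mat_diag n (\<lambda>i. of_real (f (i + 1) c y))" for y
    by (simp add: H_def direct_sum_metric_def)
  have Fpos: "F j > 0" if "j < n" for j using pos[of "j + 1" x] that x by (simp add: F_def)
  show ?thesis
  proof (rule has_laplacian_ln_smooth[OF S(1) _ _ x, where G = G])
    have "smooth_on (coord c ` cdom c) (\<lambda>w. H c (chart_inv c w) $$ (i, i))"
      using harm c(1) i by (auto simp: harmonic_metric_def hermitian_metric_def H_def)
    then have "smooth_on (coord c ` cdom c) (\<lambda>w. complex_of_real (f (i + 1) c (chart_inv c w)))"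
      using i by (simp add: H_diag mat_diag_def)
    then show "smooth_on S (\<lambda>w. complex_of_real (f (i + 1) c (chart_inv c w)))"
      by (rule smooth_on_subset[OF _ S(2)])
    show "f (i + 1) c (chart_inv c w) > 0" if "w \<in> S" for w using pos[of "i + 1" w] that i by simp
    show "G w = of_real (1 / f (i + 1) c (chart_inv c w)) *
        ddz (\<lambda>w. of_real (f (i + 1) c (chart_inv c w))) w" if "w \<in> S" for w
    proof -
      have "f (j + 1) c (chart_inv c w) > 0" if "j < n" for j
        using pos[of "j + 1" w] that \<open>w \<in> S\<close> by simp
      then have inv: "inverse_mat (H c (chart_inv c w)) = mat_diag n (\<lambda>i. 1 / of_real (f (i + 1) c (chart_inv c w)))"
        unfolding H_diag by (intro inverse_mat_diag) force
      have "mat_ddz n (\<lambda>w. H c (chart_inv c w)) w \<in> carrier_mat n n" by (simp add: mat_ddz_def)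
      from mat_diag_mult_left[OF this] show ?thesis
        using i unfolding G_def inv by (simp add: mat_ddz_def H_diag mat_diag_def)
    qed
    have "chern_curvature n H c p +
        (higgs_field n t q c p * adjoint_wrt (H c p) (higgs_field n t q c p) -
         adjoint_wrt (H c p) (higgs_field n t q c p) * higgs_field n t q c p) = 0\<^sub>m n n"
      (is "_ + ?K = _")
      using harm c(1) p(1) by (auto simp: harmonic_metric_def H_def)
    then have eq: "(chern_curvature n H c p + ?K) $$ (i, i) = 0" using i by simp
    have "adjoint_wrt (H c p) (higgs_field n t q c p) * higgs_field n t q c p \<in> carrier_mat n n"
    proof -
      have "dim_row (inverse_mat (H c p)) = n"
        by (simp add: inverse_mat_def adj_mat_def H_diag mat_diag_def)
      then show ?thesis by (intro carrier_matI) (simp_all add: adjoint_wrt_def higgs_field_def)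
    qed
    then have "?K \<in> carrier_mat n n" by (rule minus_carrier_mat)
    then have "i < dim_row ?K" "i < dim_col ?K" using i by (simp_all only: carrier_matD)
    from index_add_mat(1)[OF this, of "chern_curvature n H c p"] eq
    have "chern_curvature n H c p $$ (i, i) + ?K $$ (i, i) = 0" by (simp only:)
    moreover have "chern_curvature n H c p $$ (i, i) = - ddzbar G x"
      using i p(2) by (simp add: chern_curvature_def mat_ddzbar_def G_def[abs_def])
    ultimately have "ddzbar G x = ?K $$ (i, i)" by (simp add: neg_eq_iff_add_eq_0)
    also have "\<dots> = of_real ((if i = 0 then Q\<^sup>2 * F 0 / F (n - 1) else F i / F (i - 1)) -
      (if i = n - 1 then Q\<^sup>2 * F 0 / F (n - 1) else F (i + 1) / F i))"
      using higgs_commutator_diag[OF n i, of F t q c p, OF Fpos t]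
      by (simp only: H_diag F_def Q_def p_def)
    finally show "ddzbar G x = of_real ((if i = 0 then Q\<^sup>2 * F 0 / F (n - 1) else F i / F (i - 1)) -
      (if i = n - 1 then Q\<^sup>2 * F 0 / F (n - 1) else F (i + 1) / F i))" .
  qed
qed

section \<open>The Toda system for the error functions\<close>

lemma cyclic_error_periodic: "cyclic_error n u (i + n) = cyclic_error n u i"
  by (simp add: cyclic_error_def fun_eq_iff)

text \<open>The exponents of t|q| are arithmetic with step 2/n, so all quotients of consecutive
  metrics, including the one closing the cycle, share the factor (t|q|)^(2/n). As ln |q| is harmonic
  off the zeros, subtracting it leaves the Laplacian of ln h up to sign.\<close>

lemma error_laplacian_chart:
  fixes f :: "nat \<Rightarrow> 'a chart \<Rightarrow> 'a \<Rightarrow> real" and q :: "'a chart \<Rightarrow> 'a \<Rightarrow> complex" and t :: real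
  assumes c: "c \<in> A" "complex_chart X c" and n: "n \<ge> 2" and t: "t > 0"
    and q: "holomorphic_differential A n q"
    and harm: "harmonic_metric A n s (higgs_field n t q) (direct_sum_metric n f)"
    and err: "error_functions A n q t f u"
    and p: "p \<in> cdom c" "q c p \<noteq> 0"
  shows "has_laplacian (\<lambda>w. cyclic_error n u j (chart_inv c w))
    (4 * (t * cmod (q c p)) powr (2 / n) *
      (exp (cyclic_error n u j p - cyclic_error n u (j + 1) p) -
       exp (cyclic_error n u (j + n - 1) p - cyclic_error n u j p))) (coord c p)"
proof -
  define x where "x = coord c p"
  define B where "B = coord c ` cdom c"
  have B: "open B" "x \<in> B" using c p by (auto simp: B_def x_def complex_chart_def)
  have px: "chart_inv c x = p" unfolding x_def by (rule chart_inv_coord[OF c(2) p(1)])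
  define qc where "qc = q c \<circ> chart_inv c"
  have hol: "qc holomorphic_on B"
    using q c(1) by (auto simp: holomorphic_differential_def qc_def B_def)
  define S where "S = B \<inter> qc -` (- {0})"
  have S: "open S" "S \<subseteq> coord c ` cdom c" "x \<in> S" "S \<subseteq> B"
    using B p px continuous_open_preimage[OF holomorphic_on_imp_continuous_on[OF hol] B(1), of "- {0}"]
    by (auto simp: S_def qc_def B_def)
  define e where "e k = (real n + 1 - 2 * real k) / real n" for k
  have f_eq: "f k c (chart_inv c w) = (t * cmod (qc w)) powr (- e k) * exp (- u k (chart_inv c w))"
    if "k \<in> {1..n}" "w \<in> S" for k w
    using err that c(1) S chart_inv_in_cdom[of w c]
    unfolding error_functions_def e_def by (auto simp: S_def qc_def B_def)
  have Qpos: "t * cmod (qc w) > 0" if "w \<in> S" for w using that t by (auto simp: S_def)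
  have f_pos: "f k c (chart_inv c w) > 0" if "k \<in> {1..n}" "w \<in> S" for k w
  proof -
    have "t * cmod (qc w) \<noteq> 0" using Qpos[OF that(2)] by linarith
    then show ?thesis by (simp add: f_eq[OF that])
  qed
  define Q where "Q = t * cmod (q c p)"
  have Q: "Q > 0" using t p by (simp add: Q_def)
  define F where "F i = f (i + 1) c p" for i
  have F: "F i = Q powr (- e (i + 1)) * exp (- u (i + 1) p)" if "i < n" for i
    using f_eq[of "i + 1" x] that S by (simp add: F_def px Q_def qc_def)
  have ratio: "F (i + 1) / F i = Q powr (2 / n) * exp (u (i + 1) p - u (i + 2) p)" if "i + 1 < n" for i
  proof -
    have "- e (i + 2) = 2 / n + - e (i + 1)" using n by (simp add: e_def field_simps)
    then have "Q powr (- e (i + 2)) = Q powr (2 / n) * Q powr (- e (i + 1))"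
      by (simp only: powr_add)
    then show ?thesis using that Q by (simp add: F exp_diff exp_minus field_simps)
  qed
  \<comment> \<open>The square of Q from the Higgs entry compensates the jump from the last exponent
    to the first: 2 - e_1 = 2/n - e_n.\<close>
  have wrap: "Q\<^sup>2 * F 0 / F (n - 1) = Q powr (2 / n) * exp (u n p - u 1 p)"
  proof -
    have "2 + - e 1 = 2 / n + - e n" using n by (simp add: e_def field_simps)
    then have "Q powr 2 * Q powr (- e 1) = Q powr (2 / n) * Q powr (- e n)"
      by (simp only: powr_add[symmetric])
    moreover have "Q powr 2 = Q\<^sup>2" using Q by simp
    ultimately have eq: "Q\<^sup>2 * Q powr (- e 1) = Q powr (2 / n) * Q powr (- e n)" by simp
    have F0: "F 0 = Q powr (- e 1) * exp (- u 1 p)" using F[of 0] n by simp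
    have Fn: "F (n - 1) = Q powr (- e n) * exp (- u n p)" using F[of "n - 1"] n by simp
    have "Q\<^sup>2 * F 0 / F (n - 1) = (Q\<^sup>2 * Q powr (- e 1)) * exp (- u 1 p) / F (n - 1)"
      by (simp only: F0 mult.assoc)
    also have "\<dots> = Q powr (2 / n) * exp (u n p - u 1 p)"
    proof -
      have "a * b * exp (- x) / (b * exp (- y)) = a * exp (y - x)" if "b \<noteq> 0" for a b x y :: real
        using that by (simp add: exp_diff exp_minus field_simps)
      moreover have "Q powr (- e n) \<noteq> 0" using Q by simp
      ultimately show ?thesis unfolding eq Fn by blast
    qed
    finally show ?thesis .
  qed
  \<comment> \<open>\<open>k\<close> represents j in 1..n and \<open>i\<close> is its matrix
    position counted from 0; the neighbours wrap at i = 0 and i = n - 1.\<close>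
  define k where "k = (if j mod n = 0 then n else j mod n)"
  have k: "k \<in> {1..n}" using n by (auto simp: k_def Suc_le_eq intro: less_imp_le)
  obtain i where i: "k = i + 1" "i < n" using k by (cases k) auto
  have dj: "cyclic_error n u j = u (i + 1)" using i by (simp add: cyclic_error_def k_def)
  have modk: "j mod n = k mod n" by (simp add: k_def)
  have dnext: "cyclic_error n u (j + 1) = (if i = n - 1 then u 1 else u (i + 2))"
  proof -
    have "(j + 1) mod n = (k + 1) mod n" using modk by (metis mod_add_left_eq)
    then show ?thesis using i n by (auto simp: cyclic_error_def mod_Suc)
  qed
  have dprev: "cyclic_error n u (j + n - 1) = (if i = 0 then u n else u i)"
  proof -
    have "(j + (n - 1)) mod n = (k + (n - 1)) mod n" using modk by (metis mod_add_left_eq)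
    also have "k + (n - 1) = i + n" using i n by simp
    finally show ?thesis using i n by (auto simp: cyclic_error_def)
  qed
  have "has_laplacian (\<lambda>w. ln (f (i + 1) c (chart_inv c w)))
    (4 * ((if i = 0 then Q\<^sup>2 * F 0 / F (n - 1) else F i / F (i - 1)) -
      (if i = n - 1 then Q\<^sup>2 * F 0 / F (n - 1) else F (i + 1) / F i))) x"
    using higgs_log_laplacian[OF c n i(2) t harm S(1,2,3) f_pos] by (simp only: px Q_def F_def)
  moreover have "(if i = 0 then Q\<^sup>2 * F 0 / F (n - 1) else F i / F (i - 1)) =
      Q powr (2 / n) * exp (cyclic_error n u (j + n - 1) p - cyclic_error n u j p)"
    using wrap ratio[of "i - 1"] i by (auto simp: dj dprev[simplified])
  moreover have "(if i = n - 1 then Q\<^sup>2 * F 0 / F (n - 1) else F (i + 1) / F i) =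
      Q powr (2 / n) * exp (cyclic_error n u j p - cyclic_error n u (j + 1) p)"
    using wrap ratio[of i] i n by (auto simp: dj dnext[simplified])
  ultimately have lf: "has_laplacian (\<lambda>w. ln (f (i + 1) c (chart_inv c w)))
    (4 * (Q powr (2 / n) * exp (cyclic_error n u (j + n - 1) p - cyclic_error n u j p) -
      Q powr (2 / n) * exp (cyclic_error n u j p - cyclic_error n u (j + 1) p))) x" by simp
  have "(\<lambda>w. of_real t * qc w) holomorphic_on S"
    using hol S(4) by (intro holomorphic_intros) (auto intro: holomorphic_on_subset)
  then have lq: "has_laplacian (\<lambda>w. ln (cmod (of_real t * qc w))) 0 x"
    using S(1,3) Qpos[OF S(3)] by (intro has_laplacian_ln_norm_holomorphic) auto
  have "has_laplacian (\<lambda>w. (- e k) * ln (cmod (of_real t * qc w)) - ln (f (i + 1) c (chart_inv c w)))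
    ((- e k) * 0 - (4 * (Q powr (2 / n) * exp (cyclic_error n u (j + n - 1) p - cyclic_error n u j p) -
      Q powr (2 / n) * exp (cyclic_error n u j p - cyclic_error n u (j + 1) p)))) x"
    by (intro has_laplacian_diff has_laplacian_cmult lf lq)
  then have "has_laplacian (\<lambda>w. cyclic_error n u j (chart_inv c w))
    ((- e k) * 0 - (4 * (Q powr (2 / n) * exp (cyclic_error n u (j + n - 1) p - cyclic_error n u j p) -
      Q powr (2 / n) * exp (cyclic_error n u j p - cyclic_error n u (j + 1) p)))) x"
  proof (rule has_laplacian_cong)
    show "\<forall>\<^sub>F w in nhds x. (- e k) * ln (cmod (of_real t * qc w)) - ln (f (i + 1) c (chart_inv c w)) =
        cyclic_error n u j (chart_inv c w)"
      using eventually_nhds_in_open[OF S(1,3)]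
    proof eventually_elim
      case (elim w)
      have "ln (f (i + 1) c (chart_inv c w)) = (- e k) * ln (t * cmod (qc w)) - u k (chart_inv c w)"
        using f_eq[of k w] k elim t i by (simp add: ln_mult ln_powr S_def)
      then show ?case using t i by (simp add: dj norm_mult)
    qed
  qed
  then show ?thesis by (simp add: x_def Q_def algebra_simps)
qed

text \<open>The metric is given in charts of \<open>A\<close>, with which \<open>z\<close> is only
  compatible, so the equation is transported from a chart around each point. As q is dz^n, the
  factor |q|^(2/n) is |dz/dz_c|^2 and cancels the conformal factor, leaving t^(2/n).\<close>

lemma error_cyclic_toda:
  fixes f :: "nat \<Rightarrow> 'a chart \<Rightarrow> 'a \<Rightarrow> real" and q :: "'a chart \<Rightarrow> 'a \<Rightarrow> complex" and t :: real
  assumes X: "closed_riemann_surface X A" and n: "n \<ge> 2" and t: "t > 0"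
    and q: "holomorphic_differential A n q"
    and harm: "harmonic_metric A n s (higgs_field n t q) (direct_sum_metric n f)"
    and err: "error_functions A n q t f u"
    and z: "local_coordinate X A z"
    and qz: "\<forall>c\<in>A. \<forall>p \<in> cdom c \<inter> cdom z. q c p = dcoord c z p ^ n"
  shows "cyclic_toda n (t powr (1 / n)) (coord z ` cdom z) (\<lambda>i x. cyclic_error n u i (chart_inv z x))"
proof
  fix i j x
  show "n > 0" "t powr (1 / n) > 0" using n t by auto
  show "(\<lambda>x. cyclic_error n u (i + n) (chart_inv z x)) = (\<lambda>x. cyclic_error n u i (chart_inv z x))"
    by (simp add: cyclic_error_periodic)
  assume x: "x \<in> coord z ` cdom z"
  define p where "p = chart_inv z x"
  have pz: "p \<in> cdom z" "coord z p = x"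
    using coord_chart_inv[OF x] chart_inv_in_cdom[OF x] by (auto simp: p_def)
  have zc: "complex_chart X z" and zcomp: "\<And>c. c \<in> A \<Longrightarrow> compatible c z"
    using z by (auto simp: local_coordinate_def)
  have "p \<in> topspace X" using pz(1) zc openin_subset by (auto simp: complex_chart_def)
  moreover have "(\<Union>c\<in>A. cdom c) = topspace X" using X unfolding closed_riemann_surface_def by blast
  ultimately obtain c where c: "c \<in> A" "p \<in> cdom c" by blast
  have cc: "complex_chart X c" using X c(1) by (auto simp: closed_riemann_surface_def)
  define \<psi> where "\<psi> = transition z c"
  define V where "V = coord z ` (cdom z \<inter> cdom c)"
  have V: "open V" "x \<in> V"
    using open_coord_image[OF zc, of "cdom c"] cc pz c(2) by (auto simp: V_def complex_chart_def)
  have hol: "\<psi> holomorphic_on V"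
    using zcomp[OF c(1)] by (auto simp: compatible_def \<psi>_def V_def Int_commute)
  have \<psi>x: "\<psi> x = coord c p" by (simp add: \<psi>_def transition_def p_def)
  have one: "deriv \<psi> x * dcoord c z p = 1"
    using dcoord_inverse[OF cc zc zcomp[OF c(1)] c(2) pz(1)] by (simp add: \<psi>_def pz)
  have qp: "q c p = dcoord c z p ^ n" using qz c pz by auto
  have dnz: "dcoord c z p \<noteq> 0" using one by auto
  have "has_laplacian (\<lambda>w. cyclic_error n u i (chart_inv c w))
    (4 * (t * cmod (q c p)) powr (2 / n) *
      (exp (cyclic_error n u i p - cyclic_error n u (i + 1) p) -
       exp (cyclic_error n u (i + n - 1) p - cyclic_error n u i p))) (\<psi> x)"
    unfolding \<psi>x by (rule error_laplacian_chart[OF c(1) cc n t q harm err c(2)]) (simp add: qp dnz)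
  from has_laplacian_compose_holomorphic[OF this V hol]
  have "has_laplacian (\<lambda>w. cyclic_error n u i (chart_inv z w))
    (4 * (t * cmod (q c p)) powr (2 / n) *
      (exp (cyclic_error n u i p - cyclic_error n u (i + 1) p) -
       exp (cyclic_error n u (i + n - 1) p - cyclic_error n u i p)) * (cmod (deriv \<psi> x))\<^sup>2) x"
  proof (rule has_laplacian_cong)
    show "\<forall>\<^sub>F w in nhds x. cyclic_error n u i (chart_inv c (\<psi> w)) = cyclic_error n u i (chart_inv z w)"
      using eventually_nhds_in_open[OF V]
      by eventually_elim (auto simp: V_def \<psi>_def transition_def chart_inv_coord[OF zc] chart_inv_coord[OF cc])
  qed
  moreover have scale: "(t * cmod (q c p)) powr (2 / n) * (cmod (deriv \<psi> x))\<^sup>2 = (t powr (1 / n))\<^sup>2"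
  proof -
    have "(cmod (dcoord c z p) ^ n) powr (2 / n) = cmod (dcoord c z p) powr (real n * (2 / n))"
      using dnz by (subst powr_realpow[symmetric]) (simp_all add: powr_powr)
    also have "\<dots> = (cmod (dcoord c z p))\<^sup>2" using dnz n by simp
    finally have "(t * cmod (q c p)) powr (2 / n) = t powr (2 / n) * (cmod (dcoord c z p))\<^sup>2"
      using t by (simp add: qp norm_power powr_mult)
    moreover have "(cmod (dcoord c z p))\<^sup>2 * (cmod (deriv \<psi> x))\<^sup>2 = 1"
      using arg_cong[OF one, of cmod] by (simp add: norm_mult mult.commute flip: power_mult_distrib)
    moreover have "(t powr (1 / n))\<^sup>2 = t powr (2 / n)"
      unfolding power2_eq_square powr_add[symmetric] by simp
    ultimately show ?thesis by simp
  qed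
  moreover have "4 * (t * cmod (q c p)) powr (2 / n) * Y * (cmod (deriv \<psi> x))\<^sup>2 = 4 * (t powr (1 / n))\<^sup>2 * Y" for Y
    unfolding scale[symmetric] by simp
  ultimately show "has_laplacian (\<lambda>x. cyclic_error n u i (chart_inv z x))
     (4 * (t powr (1 / n))\<^sup>2 *
      (exp (cyclic_error n u i (chart_inv z x) - cyclic_error n u (i + 1) (chart_inv z x)) -
       exp (cyclic_error n u (i + n - 1) (chart_inv z x) - cyclic_error n u i (chart_inv z x)))) x"
    unfolding p_def by (simp only:)
qed

section \<open>The estimate on the surface\<close>

lemma fourier_error_eq_dft:
  assumes "n > 0"
  shows "fourier_error n u k p =
    of_real (sqrt n) * dft n (\<lambda>i. cyclic_error n u i p - cyclic_error n u (i + 1) p) k"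
proof -
  have eq: "complex_of_real (sqrt n) / of_nat n = 1 / of_real (sqrt n)"
    using assms by (simp add: field_simps flip: of_real_mult)
  have "1 / of_real (sqrt n) * S = of_real (sqrt n) * (S / of_nat n)" for S :: complex
    unfolding eq[symmetric] by simp
  then show ?thesis unfolding fourier_error_def dft_def .
qed

lemma cball_extend_ball:
  fixes B :: "complex set"
  assumes "open B" "cball 0 R \<subseteq> B" "R > 0"
  obtains R0 where "R0 > R" "ball 0 R0 \<subseteq> B"
proof -
  obtain e where e: "e > 0" "(\<Union>x\<in>cball 0 R. ball x e) \<subseteq> B"
    using compact_subset_open_imp_ball_epsilon_subset[OF compact_cball assms(1,2)] by metis
  have "ball 0 (R + e) \<subseteq> B"
  proof
    fix w :: complex assume w: "w \<in> ball 0 (R + e)"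
    show "w \<in> B"
    proof (cases "cmod w \<le> R")
      case True
      then show ?thesis using assms(2) by auto
    next
      case False
      \<comment> \<open>The radial projection of \<open>w\<close> to the circle of radius R, at
        distance |w| - R < e.\<close>
      define y where "y = of_real (R / cmod w) * w"
      have w0: "w \<noteq> 0" using False assms(3) by (metis norm_zero less_imp_le)
      have y: "cmod y = R" using w0 assms(3) by (auto simp: y_def norm_mult norm_divide)
      have "w - y = of_real (1 - R / cmod w) * w" by (simp add: y_def algebra_simps)
      then have "cmod (w - y) = \<bar>1 - R / cmod w\<bar> * cmod w" by (simp only: norm_mult norm_of_real)
      also have "\<dots> = cmod w - R" using w0 False assms(3) by (simp add: abs_if field_simps)
      finally have "w \<in> ball y e" using w by (simp add: dist_norm norm_minus_commute)
      then show ?thesis using e y by force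
    qed
  qed
  with e(1) show ?thesis by (intro that[of "R + e"]) auto
qed

theorem theorem6p1:
  fixes X :: "'a topology" and A :: "'a chart set" and g n :: nat
    and s :: "'a chart \<Rightarrow> 'a chart \<Rightarrow> 'a \<Rightarrow> complex"
    and q :: "'a chart \<Rightarrow> 'a \<Rightarrow> complex"
    and h :: "real \<Rightarrow> nat \<Rightarrow> 'a chart \<Rightarrow> 'a \<Rightarrow> real"
    and u :: "real \<Rightarrow> nat \<Rightarrow> 'a \<Rightarrow> real"
    and P :: 'a and z :: "'a chart" and R :: real
  assumes "closed_riemann_surface X A" and "has_genus X g" and "g \<ge> 2" and "n \<ge> 2"
    and "canonical_sqrt A s"
    and "holomorphic_differential A n q" and "\<exists>c\<in>A. \<exists>p\<in>cdom c. q c p \<noteq> 0"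
    and "\<And>t. t > 0 \<Longrightarrow> harmonic_metric A n s (higgs_field n t q) (direct_sum_metric n (h t))"
    and "\<And>t. t > 0 \<Longrightarrow> error_functions A n q t (h t) (u t)"
    and "P \<in> topspace X" and "\<forall>c\<in>A. P \<in> cdom c \<longrightarrow> q c P \<noteq> 0"
    and "local_coordinate X A z" and "P \<in> cdom z" and "coord z P = 0"
    and "\<forall>c\<in>A. \<forall>p \<in> cdom c \<inter> cdom z. q c p = dcoord c z p ^ n"
    and "R > 0" and "cball 0 R \<subseteq> coord z ` cdom z"
  shows "\<forall>k::int. \<exists>C. \<forall>\<^sub>F t in at_top. \<forall>p \<in> {p \<in> cdom z. cmod (coord z p) < R}.
    cmod (fourier_error n (u t) k p)
      \<le> C * (t powr (- (3 / (2 * real n))) *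
             exp (- 2 * cmod (1 - zeta n powi k) * t powr (1 / real n) * (R - cmod (coord z p))))"
proof
  fix k :: int
  have n: "n > 0" using assms(4) by simp
  have zc: "complex_chart X z" using assms(12) by (simp add: local_coordinate_def)
  then have "open (coord z ` cdom z)" by (simp add: complex_chart_def)
  from cball_extend_ball[OF this assms(17,16)] obtain R0 where
    R0: "R < R0" "ball 0 R0 \<subseteq> coord z ` cdom z" by metis
  \<comment> \<open>Reparametrised by T, with t = T^n, so that the rates are linear in the
    parameter.\<close>
  define d where "d T i x = cyclic_error n (u (T ^ n)) i (chart_inv z x)" for T :: real and i x
  have toda: "cyclic_toda n T (ball 0 R0) (d T)" if "T > 0" for T
  proof -
    have "cyclic_toda n ((T ^ n) powr (1 / n)) (coord z ` cdom z)
        (\<lambda>i x. cyclic_error n (u (T ^ n)) i (chart_inv z x))"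
      using that by (intro error_cyclic_toda[OF assms(1,4) _ assms(6) assms(8) assms(9) assms(12) assms(15)]) auto
    moreover have "(T ^ n) powr (1 / n) = T"
      using that n by (simp add: powr_powr flip: powr_realpow)
    ultimately show ?thesis
      using R0(2) by (auto simp: d_def[abs_def] intro: cyclic_toda_subset)
  qed
  show "\<exists>C. \<forall>\<^sub>F t in at_top. \<forall>p \<in> {p \<in> cdom z. cmod (coord z p) < R}.
    cmod (fourier_error n (u t) k p)
      \<le> C * (t powr (- (3 / (2 * real n))) *
             exp (- 2 * cmod (1 - zeta n powi k) * t powr (1 / real n) * (R - cmod (coord z p))))"
  \<comment> \<open>If n divides k there is no exponential decay to gain, but the mode is a
    telescoping sum around the cycle and vanishes.\<close>
  proof (cases "int n dvd k")
    case True
    have "fourier_error n (u t) k p = 0" for t p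
      unfolding fourier_error_eq_dft[OF n]
      using dft_difference_eq_0[of "\<lambda>i. cyclic_error n (u t) i p" n k] n True
      by (simp add: cyclic_error_periodic)
    then show ?thesis by (intro exI[of _ 0]) simp
  next
    case False
    from cyclic_toda_decay[OF n assms(16) R0(1) toda False] obtain a where a: "a > 0"
      "\<forall>\<^sub>F T in at_top. \<forall>x \<in> ball 0 R.
        cmod (dft n (\<lambda>i. d T i x - d T (i + 1) x) k) \<le> exp (- (2 * freq n k * T * (R - cmod x))) * exp (- a * T)"
      by blast
    \<comment> \<open>The spare exponential beats every power of T; T^(-3/2) is t^(-3/(2n)).\<close>
    have "\<forall>\<^sub>F T in at_top. exp (- a * T) \<le> T powr (- (3 / 2))"
      using a(1) by real_asymp
    with a(2) have ev: "\<forall>\<^sub>F T in at_top. (\<forall>x \<in> ball 0 R.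
        cmod (dft n (\<lambda>i. d T i x - d T (i + 1) x) k) \<le> exp (- (2 * freq n k * T * (R - cmod x))) * exp (- a * T))
        \<and> exp (- a * T) \<le> T powr (- (3 / 2))"
      by (rule eventually_conj)
    have "filterlim (\<lambda>t. t powr (1 / n)) at_top at_top"
      using n by (intro real_powr_at_top) simp
    from eventually_compose_filterlim[OF ev this] eventually_gt_at_top[of 0]
    have "\<forall>\<^sub>F t in at_top. \<forall>p \<in> {p \<in> cdom z. cmod (coord z p) < R}.
      cmod (fourier_error n (u t) k p)
      \<le> sqrt n * (t powr (- (3 / (2 * real n))) *
             exp (- 2 * cmod (1 - zeta n powi k) * t powr (1 / real n) * (R - cmod (coord z p))))"
    proof eventually_elim
      case (elim t)
      show ?case
      proof safe
        fix p assume p: "p \<in> cdom z" "cmod (coord z p) < R"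
        define T where "T = t powr (1 / n)"
        have Tn: "T ^ n = t" using elim(2) n by (simp add: T_def powr_powr flip: powr_realpow)
        have T3: "T powr (- (3 / 2)) = t powr (- (3 / (2 * real n)))"
          by (simp add: T_def powr_powr mult.commute)
        let ?x = "coord z p"
        have "cmod (dft n (\<lambda>i. d T i ?x - d T (i + 1) ?x) k) \<le> exp (- (2 * freq n k * T * (R - cmod ?x))) * exp (- a * T)"
          using elim(1) p by (simp add: T_def)
        also have "\<dots> \<le> exp (- (2 * freq n k * T * (R - cmod ?x))) * t powr (- (3 / (2 * real n)))"
          using elim(1) unfolding T3[symmetric] by (intro mult_left_mono) (auto simp: T_def)
        finally have "cmod (dft n (\<lambda>i. d T i ?x - d T (i + 1) ?x) k) \<le>
            exp (- (2 * freq n k * T * (R - cmod ?x))) * t powr (- (3 / (2 * real n)))" .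
        then have "sqrt n * cmod (dft n (\<lambda>i. d T i ?x - d T (i + 1) ?x) k) \<le>
            sqrt n * (exp (- (2 * freq n k * T * (R - cmod ?x))) * t powr (- (3 / (2 * real n))))"
          by (intro mult_left_mono) auto
        moreover have "cmod (fourier_error n (u t) k p) = sqrt n * cmod (dft n (\<lambda>i. d T i ?x - d T (i + 1) ?x) k)"
          unfolding fourier_error_eq_dft[OF n] norm_mult
          by (simp add: d_def Tn chart_inv_coord[OF zc p(1)])
        ultimately show "cmod (fourier_error n (u t) k p)
          \<le> sqrt n * (t powr (- (3 / (2 * real n))) *
             exp (- 2 * cmod (1 - zeta n powi k) * t powr (1 / real n) * (R - cmod (coord z p))))"
          by (simp add: freq_def T_def mult_ac)
      qed
    qed
    then show ?thesis by blast
  qed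
qed

end
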